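(* On the torus $S^1 \times S^1$ there exists a unique measure $\nu$ with density of the form $\psi(\langle x,y\rangle)$ with respect to $\sigma_1 \otimes \sigma_1$ such that, for all smooth functions $f,g$ on $S^1$, $$ \mathrm{cov}_{\sigma_1}(f,g) = \int_{S^1}\int_{S^1} \langle\nabla_S f(x),\nabla_S g(y)\rangle\, d\nu(x,y). $$ The function $\psi(\alpha)$ is positive, increasing, continuous for $|\alpha| \leq 1$, and is given by $$ \psi(\cos h) = (2\pi)^2\, \frac{K\big(\frac{h}{2\pi}\big)}{\cos h}, \quad 0 \leq h \leq 2\pi, $$ with $$ K(h) = \frac{1}{32}\,(4h-1)(4h-3), \quad 0 \leq h \leq 1 $$ (at the points where $\cos h = 0$ the right-hand side is understood by continuity). In addition, $\frac{\pi^2}{8} \leq \psi(\alpha) \leq \frac{3\pi^2}{8}$, where equalities are attained for $\alpha=-1$ and $\alpha=1$, respectively.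
   Context: $S^1$ is the unit circle in $\mathbb{R}^2$ and $\sigma_1$ the uniform probability measure on it; $\mathrm{cov}_{\sigma_1}(f,g) = \int fg\,d\sigma_1 - \int f\,d\sigma_1\int g\,d\sigma_1$. "Smooth" means $C^1$-smooth. The spherical gradient $\nabla_S f(x) \in \mathbb{R}^2$ is the shortest vector $w$ satisfying $f(x') = f(x) + \langle w, x'-x\rangle + o(|x'-x|)$ as $x' \to x$, $x' \in S^1$; for $u(t) = f(\cos t,\sin t)$ it equals $u'(t)(-\sin t,\cos t)$ at $x = (\cos t,\sin t)$. Measures $\nu$ here are finite and may a priori be signed (so uniqueness is among all finite signed measures with density of the form $\psi(\langle x,y\rangle)$; $\psi$ denotes the continuous version of the density function). *)

theory Defs
  imports "HOL-Analysis.Analysis"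
begin

abbreviation circle :: "(real^2) set" where
  "circle \<equiv> sphere 0 1"

text \<open>The law of \<open>(cos t, sin t)\<close> for an angle \<open>t\<close> uniform on \<open>[0, 2\<pi>)\<close>.\<close>

definition sigma1 :: "(real^2) measure" where
  "sigma1 = distr (uniform_measure lborel {0..<2*pi}) (restrict_space borel circle)
              (\<lambda>t. vector [cos t, sin t])"

abbreviation torus_measure :: "((real^2) \<times> (real^2)) measure" where
  "torus_measure \<equiv> sigma1 \<Otimes>\<^sub>M sigma1"

definition covariance :: "'a measure \<Rightarrow> ('a \<Rightarrow> real) \<Rightarrow> ('a \<Rightarrow> real) \<Rightarrow> real" where
  "covariance M f g = (\<integral>x. f x * g x \<partial>M) - (\<integral>x. f x \<partial>M) * (\<integral>x. g x \<partial>M)"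

text \<open>Functions on the circle are total functions on the plane of which only the values on the
  circle matter: the derivative is taken within the circle, so the vectors \<open>w\<close> below are
  determined only up to multiples of \<open>x\<close>, and the shortest one is tangential.\<close>

definition spherical_gradient :: "(real^2 \<Rightarrow> real) \<Rightarrow> real^2 \<Rightarrow> real^2" where
  "spherical_gradient f x =
     (ARG_MIN norm w. (f has_derivative (\<lambda>v. w \<bullet> v)) (at x within circle))"

definition C1_on_circle :: "(real^2 \<Rightarrow> real) \<Rightarrow> bool" where
  "C1_on_circle f \<longleftrightarrow>
     f differentiable_on circle \<and> continuous_on circle (spherical_gradient f)"

text \<open>Finite signed measures on the \<open>\<sigma>\<close>-algebra of \<open>M\<close>, as countably additive real-valued set
  functions; the value 0 outside \<open>sets M\<close> is a convention making equality of set functions the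
  equality of signed measures.\<close>

definition signed_measure :: "'a measure \<Rightarrow> ('a set \<Rightarrow> real) \<Rightarrow> bool" where
  "signed_measure M \<nu> \<longleftrightarrow>
     \<nu> {} = 0 \<and>
     (\<forall>A. range A \<subseteq> sets M \<longrightarrow> disjoint_family A \<longrightarrow> (\<lambda>i::nat. \<nu> (A i)) sums \<nu> (\<Union>i. A i)) \<and>
     (\<forall>A. A \<notin> sets M \<longrightarrow> \<nu> A = 0)"

text \<open>The upper variation \<open>A \<mapsto> sup {\<nu> B | B \<subseteq> A}\<close>, i.e. the positive part of the Jordan
  decomposition. The coercion \<open>ennreal\<close> truncates negative values to 0, which does not affect
  the supremum as \<open>\<nu> {} = 0\<close>.\<close>

definition jordan_pos :: "'a measure \<Rightarrow> ('a set \<Rightarrow> real) \<Rightarrow> 'a measure" where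
  "jordan_pos M \<nu> =
     measure_of (space M) (sets M) (\<lambda>A. SUP B\<in>{B \<in> sets M. B \<subseteq> A}. ennreal (\<nu> B))"

definition jordan_neg :: "'a measure \<Rightarrow> ('a set \<Rightarrow> real) \<Rightarrow> 'a measure" where
  "jordan_neg M \<nu> = jordan_pos M (\<lambda>A. - \<nu> A)"

definition signed_integral :: "'a measure \<Rightarrow> ('a set \<Rightarrow> real) \<Rightarrow> ('a \<Rightarrow> real) \<Rightarrow> real" where
  "signed_integral M \<nu> f = (\<integral>x. f x \<partial>jordan_pos M \<nu>) - (\<integral>x. f x \<partial>jordan_neg M \<nu>)"

definition has_signed_density :: "'a measure \<Rightarrow> ('a set \<Rightarrow> real) \<Rightarrow> ('a \<Rightarrow> real) \<Rightarrow> bool" where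
  "has_signed_density M \<nu> p \<longleftrightarrow>
     integrable M p \<and> (\<forall>A\<in>sets M. \<nu> A = (LINT x:A|M. p x))"

text \<open>\<open>\<nu>\<close> has a density of the form \<open>\<psi>(\<langle>x,y\<rangle>)\<close>, with \<open>\<psi>\<close> arbitrary up to integrability, and
  represents the covariance.\<close>

definition represents_covariance :: "(((real^2) \<times> (real^2)) set \<Rightarrow> real) \<Rightarrow> bool" where
  "represents_covariance \<nu> \<longleftrightarrow>
     signed_measure torus_measure \<nu> \<and>
     (\<exists>\<psi>::real \<Rightarrow> real. has_signed_density torus_measure \<nu> (\<lambda>(x, y). \<psi> (x \<bullet> y))) \<and>
     (\<forall>f g. C1_on_circle f \<longrightarrow> C1_on_circle g \<longrightarrow>
        covariance sigma1 f g =
          signed_integral torus_measure \<nu>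
            (\<lambda>(x, y). spherical_gradient f x \<bullet> spherical_gradient g y))"

definition K :: "real \<Rightarrow> real" where
  "K h = 1 / 32 * (4 * h - 1) * (4 * h - 3)"

end

theory Submission
  imports Defs
begin

text \<open>
  Write \<open>u t = f (cos t, sin t)\<close> and \<open>v t = g (cos t, sin t)\<close>. The spherical gradients are the
  derivatives \<open>u'\<close>, \<open>v'\<close> times unit tangents, and the tangents at angles \<open>s\<close> and \<open>t\<close> have inner
  product \<open>cos (s - t)\<close>. A density \<open>\<psi> (x \<bullet> y)\<close> therefore represents the covariance iff the
  kernel \<open>k h = \<psi> (cos h) * cos h\<close> satisfies
  \<open>4 * pi\<^sup>2 * cov f g = \<integral>\<integral> u' s * v' t * k (s - t) ds dt\<close>.

  Existence. On \<open>[0, 2*pi]\<close> take the parabola \<open>kappa h = h\<^sup>2/2 - pi*h + 3*pi\<^sup>2/8\<close>, which is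
  \<open>(2*pi)\<^sup>2 * K (h/(2*pi))\<close>. Its periodic extension has slope jumping by \<open>-2*pi\<close> at the multiples
  of \<open>2*pi\<close>, so its second derivative is \<open>1 - 2*pi*\<delta>\<close>, and two integrations by parts turn
  the double integral into \<open>2*pi * \<integral>u*v - (\<integral>u) * (\<integral>v)\<close>, as required
  (\<open>covariance_kernel_inner\<close>, \<open>covariance_kernel_outer\<close>, \<open>covariance_psi\<close>). Adding a constant to
  the kernel does not change the integral, since \<open>u'\<close> and \<open>v'\<close> have mean zero; the constant
  \<open>3*pi\<^sup>2/8\<close> is the one for which \<open>kappa\<close> vanishes at \<open>pi/2\<close> and \<open>3*pi/2\<close>, where the cosine
  does, so that \<open>\<psi> (cos h) = kappa h / cos h\<close> extends continuously.

  Uniqueness. Testing with \<open>cos (n*t)\<close> and \<open>sin (n*t)\<close> and adding the two identities gives an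
  integrand that depends on \<open>x \<bullet> y\<close> only: \<open>n\<^sup>2 * (x \<bullet> y) * T (x \<bullet> y)\<close> with \<open>T\<close> the \<open>n\<close>-th
  Chebyshev polynomial. If \<open>\<phi>\<close> is the difference of two admissible densities, then
  \<open>\<alpha> * \<phi> \<alpha>\<close> is orthogonal to all Chebyshev polynomials of positive degree under the law of
  \<open>x \<bullet> y\<close>, and by Weierstrass approximation it is almost everywhere a constant \<open>c\<close>. But
  \<open>c / (x \<bullet> y)\<close> is integrable on the torus only if \<open>c = 0\<close>
  (\<open>reciprocal_inner_not_integrable\<close>, \<open>zonal_moments_determine\<close>). Thus it is the
  integrability of the density that fixes the additive constant in the kernel.

  Shape of \<open>\<psi>\<close>. In the variable \<open>\<alpha> = sin x\<close> one has \<open>\<psi> \<alpha> = x * (x + pi) / (2 * sin x)\<close>; the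
  numerator of its derivative vanishes at \<open>0\<close> and \<open>-pi/2\<close>, and the sign of its own derivative is
  evident (\<open>psi_slope_pos\<close>). Positivity and the bounds follow from monotonicity and the two
  end values.
\<close>

section \<open>Angular coordinate and spherical gradient\<close>

definition circ :: "real \<Rightarrow> real^2" where
  "circ t = vector [cos t, sin t]"

definition tang :: "real \<Rightarrow> real^2" where
  "tang t = vector [- sin t, cos t]"

lemma circ_nth [simp]: "circ t $ 1 = cos t" "circ t $ 2 = sin t"
  by (simp_all add: circ_def)

lemma tang_nth [simp]: "tang t $ 1 = - sin t" "tang t $ 2 = cos t"
  by (simp_all add: tang_def)

lemma inner_plane: "(x::real^2) \<bullet> y = x $ 1 * y $ 1 + x $ 2 * y $ 2"
  by (simp add: inner_vec_def UNIV_2)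

lemma inner_circ: "circ s \<bullet> circ t = cos (s - t)"
  and inner_tang: "tang s \<bullet> tang t = cos (s - t)"
  and inner_circ_tang [simp]: "circ t \<bullet> tang t = 0" "tang t \<bullet> circ t = 0"
  by (simp_all add: inner_plane cos_diff)

lemma norm_circ [simp]: "norm (circ t) = 1" and norm_tang [simp]: "norm (tang t) = 1"
  by (simp_all add: norm_eq_sqrt_inner inner_circ inner_tang)

lemma circ_in_circle [simp]: "circ t \<in> circle"
  by simp

lemma circle_cases:
  assumes "x \<in> circle"
  obtains t where "0 \<le> t" "t < 2 * pi" "x = circ t"
proof -
  have "(x $ 1)\<^sup>2 + (x $ 2)\<^sup>2 = 1"
    using assms by (simp add: norm_eq_sqrt_inner inner_plane power2_eq_square)
  then obtain t where "0 \<le> t" "t < 2 * pi" "x $ 1 = cos t" "x $ 2 = sin t"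
    by (rule sincos_total_2pi)
  then show ?thesis
    by (intro that[of t]) (simp_all add: vec_eq_iff forall_2)
qed

lemma circ_eq: "circ t = cos t *\<^sub>R axis 1 1 + sin t *\<^sub>R axis 2 1"
  and tang_eq: "tang t = (- sin t) *\<^sub>R axis 1 1 + cos t *\<^sub>R axis 2 1"
  by (simp_all add: vec_eq_iff forall_2 axis_def)

lemma circ_has_vector_derivative: "(circ has_vector_derivative tang t) (at t within S)"
  unfolding circ_eq[abs_def] tang_eq
  by (auto intro!: derivative_eq_intros)

lemma circ_continuous: "continuous_on S circ"
  by (rule continuous_on_vector_derivative[where f'=tang]) (rule circ_has_vector_derivative)

lemma tang_continuous: "continuous_on S tang"
  unfolding tang_eq[abs_def] by (intro continuous_intros)

lemma plane_decomposition: "w = (w \<bullet> circ t) *\<^sub>R circ t + (w \<bullet> tang t) *\<^sub>R tang t"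
proof -
  have "cos t * (cos t * a) + sin t * (sin t * a) = ((cos t)\<^sup>2 + (sin t)\<^sup>2) * a" for a
    by (simp only: power2_eq_square algebra_simps)
  then have key: "cos t * (cos t * a) + sin t * (sin t * a) = a" for a
    by simp
  have "w $ 1 = (w $ 1 * cos t + w $ 2 * sin t) * cos t + (w $ 1 * (- sin t) + w $ 2 * cos t) * (- sin t)"
    "w $ 2 = (w $ 1 * cos t + w $ 2 * sin t) * sin t + (w $ 1 * (- sin t) + w $ 2 * cos t) * cos t"
    by (simp_all add: algebra_simps key)
  then show ?thesis
    unfolding vec_eq_iff forall_2 inner_plane by simp
qed

text \<open>Derivatives within the circle are determined only up to radial functionals: \<open>(x \<bullet> x - 1) / 2\<close>
  vanishes identically on the circle and has the radial functional as its derivative in the plane.\<close>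

lemma radial_derivative_zero: "((\<lambda>_. 0::real) has_derivative (\<lambda>v. circ t \<bullet> v)) (at (circ t) within circle)"
proof -
  have "((\<lambda>x. (x \<bullet> x - 1) / 2) has_derivative (\<lambda>v. circ t \<bullet> v)) (at (circ t) within circle)"
    by (auto intro!: derivative_eq_intros simp: inner_commute)
  then show ?thesis
    by (rule has_derivative_transform[rotated 2]) (auto simp: dot_square_norm)
qed

lemma circle_derivative_imp:
  assumes "(f has_derivative D) (at (circ t) within circle)"
  shows "((\<lambda>t. f (circ t)) has_real_derivative D (tang t)) (at t)"
proof -
  have "((\<lambda>s. f (circ s)) has_derivative (\<lambda>h. D (h *\<^sub>R tang t))) (at t)"
    using has_derivative_in_compose[of circ "\<lambda>h. h *\<^sub>R tang t" t UNIV f D]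
      circ_has_vector_derivative[of t UNIV]
      has_derivative_subset[OF assms, of "range circ"]
    unfolding has_vector_derivative_def by (auto simp: image_subset_iff)
  moreover have "D (h *\<^sub>R tang t) = D (tang t) * h" for h
    using has_derivative_bounded_linear[OF assms]
    by (simp add: bounded_linear.linear linear_cmul)
  ultimately show ?thesis
    by (simp add: has_field_derivative_def mult_commute_abs)
qed

text \<open>The line of all vectors that represent the derivative within the circle: only the tangential
  component is prescribed, as any two of them differ by a radial vector.\<close>

lemma circle_derivative_iff:
  assumes "f differentiable (at (circ t) within circle)"
    and u: "((\<lambda>t. f (circ t)) has_real_derivative d) (at t)"
  shows "(f has_derivative (\<lambda>v. w \<bullet> v)) (at (circ t) within circle) \<longleftrightarrow> w \<bullet> tang t = d"
proof
  assume "(f has_derivative (\<lambda>v. w \<bullet> v)) (at (circ t) within circle)"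
  from circle_derivative_imp[OF this] u show "w \<bullet> tang t = d"
    by (rule DERIV_unique)
next
  assume w: "w \<bullet> tang t = d"
  obtain D where D: "(f has_derivative D) (at (circ t) within circle)"
    using assms(1) by (auto simp: differentiable_def)
  have Dt: "D (tang t) = d"
    using circle_derivative_imp[OF D] u by (rule DERIV_unique)
  have lin: "linear D"
    using D by (simp add: has_derivative_bounded_linear bounded_linear.linear)
  \<comment> \<open>the radial coefficient in which \<open>w\<close> and the given derivative \<open>D\<close> disagree\<close>
  define c where "c = w \<bullet> circ t - D (circ t)"
  have "((\<lambda>x. f x + c * 0) has_derivative (\<lambda>v. D v + c * (circ t \<bullet> v))) (at (circ t) within circle)"
    by (intro has_derivative_add D has_derivative_mult_right radial_derivative_zero)
  moreover have "D v + c * (circ t \<bullet> v) = w \<bullet> v" for v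
  proof -
    have "D v = (v \<bullet> circ t) * D (circ t) + (v \<bullet> tang t) * D (tang t)"
      by (subst plane_decomposition[of v t]) (simp add: linear_add[OF lin] linear_cmul[OF lin])
    moreover have "w \<bullet> v = (v \<bullet> circ t) * (w \<bullet> circ t) + (v \<bullet> tang t) * (w \<bullet> tang t)"
      by (subst plane_decomposition[of v t]) (simp add: inner_add_right)
    ultimately show ?thesis
      by (simp add: c_def Dt w algebra_simps inner_commute)
  qed
  ultimately show "(f has_derivative (\<lambda>v. w \<bullet> v)) (at (circ t) within circle)"
    by simp
qed

text \<open>By Pythagoras the tangential vector is the unique shortest one on the line described by
  \<open>circle_derivative_iff\<close>.\<close>

lemma spherical_gradient_circ:
  assumes "f differentiable (at (circ t) within circle)"
    and u: "((\<lambda>t. f (circ t)) has_real_derivative d) (at t)"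
  shows "spherical_gradient f (circ t) = d *\<^sub>R tang t"
proof -
  have min: "is_arg_min norm (\<lambda>w. w \<bullet> tang t = d) w \<longleftrightarrow> w = d *\<^sub>R tang t" for w
  proof -
    have eq: "(norm w)\<^sup>2 = (w \<bullet> circ t)\<^sup>2 + d\<^sup>2" if "w \<bullet> tang t = d" for w
    proof -
      have "w \<bullet> w = (w \<bullet> circ t) * (w \<bullet> circ t) + (w \<bullet> tang t) * (w \<bullet> tang t)"
        by (subst (2) plane_decomposition[of w t]) (simp add: inner_add_right)
      then show ?thesis
        using that by (simp only: power2_norm_eq_inner) (simp add: power2_eq_square)
    qed
    have d: "(d *\<^sub>R tang t) \<bullet> tang t = d"
      by (simp add: inner_tang)
    show ?thesis
    proof
      assume "is_arg_min norm (\<lambda>w. w \<bullet> tang t = d) w"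
      then have w: "w \<bullet> tang t = d" and "norm w \<le> norm (d *\<^sub>R tang t)"
        using d unfolding is_arg_min_linorder by blast+
      then have "(norm w)\<^sup>2 \<le> d\<^sup>2"
        using power_mono[of "norm w" "\<bar>d\<bar>" 2] by simp
      then have "w \<bullet> circ t = 0"
        using eq[OF w] by simp
      then show "w = d *\<^sub>R tang t"
        by (subst plane_decomposition[of w t]) (simp add: w)
    next
      assume w: "w = d *\<^sub>R tang t"
      have "norm w \<le> norm v" if "v \<bullet> tang t = d" for v
        by (rule power2_le_imp_le) (use eq[OF that] in \<open>simp_all add: w\<close>)
      then show "is_arg_min norm (\<lambda>w. w \<bullet> tang t = d) w"
        using d by (simp add: is_arg_min_linorder w)
    qed
  qed
  show ?thesis
    unfolding spherical_gradient_def circle_derivative_iff[OF assms] arg_min_def min some_eq_trivial ..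
qed

lemma C1_on_circle_chart:
  assumes "C1_on_circle f"
  obtains u' where "\<And>t. ((\<lambda>t. f (circ t)) has_real_derivative u' t) (at t)"
    "\<And>t. spherical_gradient f (circ t) = u' t *\<^sub>R tang t"
    "continuous_on UNIV u'"
proof
  have diff: "f differentiable (at (circ t) within circle)" for t
    using assms by (auto simp: C1_on_circle_def differentiable_on_def)
  define u' where "u' t = spherical_gradient f (circ t) \<bullet> tang t" for t
  have "((\<lambda>t. f (circ t)) has_real_derivative u' t) (at t) \<and> spherical_gradient f (circ t) = u' t *\<^sub>R tang t" for t
  proof -
    obtain D where "(f has_derivative D) (at (circ t) within circle)"
      using diff[of t] by (auto simp: differentiable_def)
    from circle_derivative_imp[OF this]
    have *: "((\<lambda>t. f (circ t)) has_real_derivative D (tang t)) (at t)" .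
    from spherical_gradient_circ[OF diff this] show ?thesis
      using * by (simp add: u'_def inner_tang)
  qed
  then show "((\<lambda>t. f (circ t)) has_real_derivative u' t) (at t)"
    "spherical_gradient f (circ t) = u' t *\<^sub>R tang t" for t by auto
  have "continuous_on UNIV (\<lambda>t. spherical_gradient f (circ t))"
    using assms unfolding C1_on_circle_def
    by (elim conjE) (rule continuous_on_compose2[OF _ circ_continuous], auto)
  then show "continuous_on UNIV u'"
    unfolding u'_def by (intro continuous_intros tang_continuous)
qed

section \<open>Integration against the uniform measure on the circle\<close>

lemma circ_measurable [measurable]: "circ \<in> lborel \<rightarrow>\<^sub>M restrict_space borel circle"
  by (rule measurable_restrict_space2)
     (auto intro!: borel_measurable_continuous_onI circ_continuous)

lemma sigma1_circ: "sigma1 = distr (uniform_measure lborel {0..<2*pi}) (restrict_space borel circle) circ"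
  by (simp add: sigma1_def circ_def[abs_def])

lemma sets_sigma1 [simp, measurable_cong]: "sets sigma1 = sets (restrict_space borel circle)"
  by (simp add: sigma1_def)

lemma space_sigma1 [simp]: "space sigma1 = circle"
  by (simp add: sigma1_def space_restrict_space)

lemma uniform_angle_density:
  "uniform_measure lborel {0..<2*pi} = density lborel (\<lambda>t. ennreal (indicator {0..<2*pi} t / (2*pi)))"
  unfolding uniform_measure_def
  by (rule arg_cong[where f="density lborel"])
     (auto simp: fun_eq_iff divide_ennreal[symmetric] split: split_indicator)

lemma
  fixes f :: "real^2 \<Rightarrow> real"
  assumes [measurable]: "f \<in> borel_measurable sigma1"
  shows integral_sigma1: "(\<integral>x. f x \<partial>sigma1) = (LINT t:{0..<2*pi}|lborel. f (circ t)) / (2*pi)"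
    and integrable_sigma1: "integrable sigma1 f \<longleftrightarrow> set_integrable lborel {0..<2*pi} (\<lambda>t. f (circ t))"
proof -
  have [measurable]: "f \<in> borel_measurable (restrict_space borel circle)"
    using assms by (simp cong: measurable_cong_sets)
  have [measurable]: "circ \<in> uniform_measure lborel {0..<2*pi} \<rightarrow>\<^sub>M restrict_space borel circle"
    using circ_measurable by (simp cong: measurable_cong_sets)
  have fc [measurable]: "(\<lambda>t. f (circ t)) \<in> borel_measurable lborel"
    by (rule measurable_compose[OF circ_measurable]) measurable
  show "(\<integral>x. f x \<partial>sigma1) = (LINT t:{0..<2*pi}|lborel. f (circ t)) / (2*pi)"
    unfolding sigma1_circ
    by (subst integral_distr; (measurable)?)
       (simp add: uniform_angle_density integral_density set_lebesgue_integral_def)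
  have "integrable sigma1 f \<longleftrightarrow> integrable lborel (\<lambda>t. (indicator {0..<2*pi} t * f (circ t)) / (2*pi))"
    unfolding sigma1_circ
    by (subst integrable_distr_eq; (measurable)?)
       (simp add: uniform_angle_density integrable_density)
  also have "\<dots> \<longleftrightarrow> set_integrable lborel {0..<2*pi} (\<lambda>t. f (circ t))"
    using integrable_mult_left_iff[of lborel "1 / (2*pi)" "\<lambda>t. indicator {0..<2*pi} t * f (circ t)"]
    by (simp add: set_integrable_def)
  finally show "integrable sigma1 f \<longleftrightarrow> set_integrable lborel {0..<2*pi} (\<lambda>t. f (circ t))" .
qed

lemma integral_sigma1_continuous:
  fixes f :: "real^2 \<Rightarrow> real"
  assumes "f \<in> borel_measurable sigma1" and cont: "continuous_on {0..2*pi} (\<lambda>t. f (circ t))"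
  shows "(\<integral>x. f x \<partial>sigma1) = integral {0..2*pi} (\<lambda>t. f (circ t)) / (2*pi)"
proof -
  have int: "set_integrable lborel {0..2*pi} (\<lambda>t. f (circ t))"
    using borel_integrable_atLeastAtMost' [OF cont] .
  have "(LINT t:{0..<2*pi}|lborel. f (circ t)) = (LINT t:{0..2*pi}|lborel. f (circ t))"
  proof (rule set_integral_cong_set)
    show "set_borel_measurable lborel {0..<2*pi} (\<lambda>t. f (circ t))"
      using set_integrable_subset[OF int, of "{0..<2*pi}"]
      unfolding set_integrable_def set_borel_measurable_def by (auto simp: subset_eq)
    show "set_borel_measurable lborel {0..2*pi} (\<lambda>t. f (circ t))"
      using int by (auto simp: set_integrable_def set_borel_measurable_def)
    have "AE t in lborel. t \<noteq> 2 * pi"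
      by (rule AE_lborel_singleton)
    then show "AE t in lborel. (t \<in> {0..2 * pi}) = (t \<in> {0..<2 * pi})"
      by eventually_elim auto
  qed
  with assms show ?thesis
    by (simp add: integral_sigma1 set_borel_integral_eq_integral(2)[OF int])
qed

lemma emeasure_sigma1: "emeasure sigma1 circle = 1"
proof -
  have "emeasure sigma1 circle = emeasure (uniform_measure lborel {0..<2*pi}) (circ -` circle \<inter> UNIV)"
    unfolding sigma1_circ
    by (subst emeasure_distr)
       (use circ_measurable in \<open>auto simp: space_restrict_space sets_restrict_space_iff cong: measurable_cong_sets\<close>)
  also have "circ -` circle \<inter> UNIV = UNIV" by auto
  also have "emeasure (uniform_measure lborel {0..<2*pi}) UNIV = 1"
    by (simp add: ennreal_divide_self)
  finally show ?thesis .
qed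

lemma finite_sigma1: "finite_measure sigma1"
  by (rule finite_measureI) (simp add: emeasure_sigma1)

interpretation sigma1: finite_measure sigma1
  by (rule finite_sigma1)

interpretation torus: pair_sigma_finite sigma1 sigma1 ..

lemma emeasure_torus: "emeasure torus_measure (space torus_measure) = 1"
proof -
  have "circle \<in> sets sigma1"
    using sets.top[of sigma1] by (simp only: space_sigma1)
  then show ?thesis
    by (simp add: space_pair_measure sigma1.emeasure_pair_measure_Times emeasure_sigma1 del: sets_sigma1)
qed

interpretation torus: finite_measure torus_measure
  by (rule finite_measureI) (simp add: emeasure_torus)

lemma AE_sigma1I:
  assumes [measurable]: "Measurable.pred sigma1 P" and "AE t in lborel. P (circ t)"
  shows "AE x in sigma1. P x"
proof -
  have "circ \<in> uniform_measure lborel {0..<2*pi} \<rightarrow>\<^sub>M restrict_space borel circle"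
    using circ_measurable by (simp cong: measurable_cong_sets)
  moreover have "{x \<in> space (restrict_space borel circle). P x} \<in> sets (restrict_space borel circle)"
    using assms(1) by (simp add: pred_def space_restrict_space)
  ultimately show ?thesis
    unfolding sigma1_circ
    by (subst AE_distr_iff) (use assms(2) in \<open>auto intro!: AE_uniform_measureI elim: eventually_mono\<close>)
qed

text \<open>The uniform measure is a probability measure, so almost-sure properties have a witness; Fubini is
  used below in this form, to pick one good section.\<close>

lemma circle_AE_E:
  assumes "AE x in sigma1. P x"
  obtains t where "0 \<le> t" "t < 2*pi" "P (circ t)"
proof -
  have "\<exists>x\<in>circle. P x"
  proof (rule ccontr)
    assume "\<not> (\<exists>x\<in>circle. P x)"
    with assms have "AE x in sigma1. False"
      by (auto elim: AE_mp)
    then have "emeasure sigma1 circle = 0"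
        by (simp add: eventually_False ae_filter_eq_bot_iff)
    then show False by (simp add: emeasure_sigma1)
  qed
  then show ?thesis
    using that by (auto elim!: circle_cases)
qed

section \<open>Signed measures with a density\<close>

text \<open>The supremum that defines the upper variation on \<open>A\<close> is attained at the part of \<open>A\<close> where the
  density is positive. The coercion \<open>ennreal\<close> truncates the density to its positive part.\<close>

lemma jordan_pos_density:
  assumes p: "integrable M p" and \<nu>: "\<And>A. A \<in> sets M \<Longrightarrow> \<nu> A = (LINT x:A|M. p x)"
  shows "jordan_pos M \<nu> = density M (\<lambda>x. ennreal (p x))"
proof -
  have [measurable]: "p \<in> borel_measurable M"
    using p by simp
  have int: "set_integrable M A p" "set_integrable M A (\<lambda>x. max 0 (p x))" if "A \<in> sets M" for A
    unfolding set_integrable_def using p that by (auto intro!: integrable_mult_indicator simp del: real_scaleR_def)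
  have pos: "emeasure (density M (\<lambda>x. ennreal (p x))) A = ennreal (LINT x:A|M. max 0 (p x))"
    if [measurable]: "A \<in> sets M" for A
  proof -
    have "emeasure (density M (\<lambda>x. ennreal (p x))) A = (\<integral>\<^sup>+x. ennreal (indicator A x * max 0 (p x)) \<partial>M)"
      by (subst emeasure_density) (auto intro!: nn_integral_cong simp: max_def ennreal_neg split: split_indicator)
    also have "\<dots> = ennreal (LINT x|M. indicator A x * max 0 (p x))"
      using int(2)[OF that] by (intro nn_integral_eq_integral) (auto simp: set_integrable_def)
    finally show ?thesis by (simp add: set_lebesgue_integral_def)
  qed
  have "(SUP B\<in>{B \<in> sets M. B \<subseteq> A}. ennreal (\<nu> B)) = emeasure (density M (\<lambda>x. ennreal (p x))) A"
    if A [measurable]: "A \<in> sets M" for A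
  proof (rule antisym)
    show "(SUP B\<in>{B \<in> sets M. B \<subseteq> A}. ennreal (\<nu> B)) \<le> emeasure (density M (\<lambda>x. ennreal (p x))) A"
    proof (rule SUP_least, clarify)
      fix B assume [measurable]: "B \<in> sets M" and "B \<subseteq> A"
      have "\<nu> B \<le> (LINT x:B|M. max 0 (p x))"
        unfolding \<nu>[OF \<open>B \<in> sets M\<close>] by (intro set_integral_mono int) auto
      then have "ennreal (\<nu> B) \<le> emeasure (density M (\<lambda>x. ennreal (p x))) B"
        by (simp add: pos ennreal_leI)
      also have "\<dots> \<le> emeasure (density M (\<lambda>x. ennreal (p x))) A"
        using \<open>B \<subseteq> A\<close> by (intro emeasure_mono) auto
      finally show "ennreal (\<nu> B) \<le> emeasure (density M (\<lambda>x. ennreal (p x))) A" .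
    qed
    define B where "B = {x \<in> space M. x \<in> A \<and> 0 < p x}"
    have [measurable]: "B \<in> sets M" unfolding B_def by measurable
    have "(LINT x:A|M. max 0 (p x)) = (LINT x:B|M. p x)"
      unfolding set_lebesgue_integral_def using sets.sets_into_space[OF A]
      by (intro Bochner_Integration.integral_cong) (auto simp: B_def max_def split: split_indicator)
    then have "emeasure (density M (\<lambda>x. ennreal (p x))) A = ennreal (\<nu> B)"
      by (simp add: pos \<nu>)
    also have "\<dots> \<le> (SUP B\<in>{B \<in> sets M. B \<subseteq> A}. ennreal (\<nu> B))"
      by (rule SUP_upper) (auto simp: B_def)
    finally show "emeasure (density M (\<lambda>x. ennreal (p x))) A \<le> (SUP B\<in>{B \<in> sets M. B \<subseteq> A}. ennreal (\<nu> B))" .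
  qed
  then have "jordan_pos M \<nu> = measure_of (space M) (sets M) (emeasure (density M (\<lambda>x. ennreal (p x))))"
    unfolding jordan_pos_def
    by (intro measure_of_eq) (auto simp: sets.sigma_sets_eq sets.space_closed)
  also have "\<dots> = density M (\<lambda>x. ennreal (p x))"
    using measure_of_of_measure[of "density M (\<lambda>x. ennreal (p x))"] by simp
  finally show ?thesis .
qed

text \<open>The positive and negative parts of the Jordan decomposition have the densities \<open>max 0 p\<close> and
  \<open>max 0 (- p)\<close>.\<close>

lemma signed_integral_density:
  assumes \<nu>: "has_signed_density M \<nu> p" and F: "F \<in> borel_measurable M"
    and int: "integrable M (\<lambda>x. p x * F x)"
  shows "signed_integral M \<nu> F = (\<integral>x. p x * F x \<partial>M)"
proof -
  have p: "integrable M p" and [measurable]: "p \<in> borel_measurable M" 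
    and \<nu>: "\<And>A. A \<in> sets M \<Longrightarrow> \<nu> A = (LINT x:A|M. p x)"
    using \<nu> by (auto simp: has_signed_density_def)
  note F [measurable]
  have dens: "(\<integral>x. F x \<partial>density M (\<lambda>x. ennreal (q x))) = (\<integral>x. max 0 (q x) * F x \<partial>M)"
    if [measurable]: "q \<in> borel_measurable M" for q
  proof -
    have "density M (\<lambda>x. ennreal (q x)) = density M (\<lambda>x. ennreal (max 0 (q x)))"
      by (rule arg_cong[where f="density M"]) (auto simp: fun_eq_iff max_def ennreal_neg)
    then show ?thesis
      by (simp add: integral_density)
  qed
  have "jordan_neg M \<nu> = density M (\<lambda>x. ennreal (- p x))"
    unfolding jordan_neg_def using p \<nu> 
    by (intro jordan_pos_density) (auto simp: set_lebesgue_integral_def)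
  then have "signed_integral M \<nu> F = (\<integral>x. max 0 (p x) * F x \<partial>M) - (\<integral>x. max 0 (- p x) * F x \<partial>M)"
    unfolding signed_integral_def by (simp add: dens jordan_pos_density[OF p \<nu>])
  also have "\<dots> = (\<integral>x. max 0 (p x) * F x - max 0 (- p x) * F x \<partial>M)"
  proof (rule Bochner_Integration.integral_diff[symmetric])
    show "integrable M (\<lambda>x. max 0 (p x) * F x)" "integrable M (\<lambda>x. max 0 (- p x) * F x)"
      by (rule Bochner_Integration.integrable_bound[OF int]; auto simp: abs_mult mult_right_mono max_def)+
  qed
  also have "\<dots> = (\<integral>x. p x * F x \<partial>M)"
    by (intro Bochner_Integration.integral_cong) (auto simp: max_def)
  finally show ?thesis .
qed

lemma signed_measure_density:
  assumes p: "integrable M p"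
  shows "signed_measure M (\<lambda>A. if A \<in> sets M then LINT x:A|M. p x else 0)"
  unfolding signed_measure_def
proof (intro conjI allI impI)
  fix A :: "nat \<Rightarrow> 'a set" assume A: "range A \<subseteq> sets M" "disjoint_family A"
  have int: "set_integrable M B p" if "B \<in> sets M" for B
    unfolding set_integrable_def using p that by (auto intro!: integrable_real_mult_indicator simp: mult.commute)
  have "(\<lambda>n. LINT x:(\<Union>i<n. A i)|M. p x) \<longlonglongrightarrow> (LINT x:(\<Union>n. \<Union>i<n. A i)|M. p x)"
    using A by (intro set_integral_cont_up int) (fastforce simp: incseq_def)+
  moreover have "(\<Union>n. \<Union>i<n. A i) = (\<Union>i. A i)"
    by auto
  moreover have "(LINT x:(\<Union>i<n. A i)|M. p x) = (\<Sum>i<n. LINT x:A i|M. p x)" for n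
    using A by (intro set_integral_finite_Union int) (auto simp: disjoint_family_on_def)
  ultimately have "(\<lambda>i. LINT x:A i|M. p x) sums (LINT x:(\<Union>i. A i)|M. p x)"
    by (simp add: sums_def)
  with A show "(\<lambda>i. if A i \<in> sets M then LINT x:A i|M. p x else 0) sums
      (if (\<Union>i. A i) \<in> sets M then LINT x:(\<Union>i. A i)|M. p x else 0)"
    by auto
qed (auto simp: set_lebesgue_integral_def)

section \<open>The profile of the density\<close>

text \<open>The numerator of \<open>\<psi> (cos h)\<close> in expanded form; it is a parabola symmetric about \<open>pi\<close> with
  zeros \<open>pi/2\<close> and \<open>3*pi/2\<close>.\<close>

definition kappa :: "real \<Rightarrow> real" where
  "kappa h = h\<^sup>2 / 2 - pi * h + 3 * pi\<^sup>2 / 8"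

text \<open>The value at \<open>0\<close> is the limit of \<open>kappa h / cos h\<close> at \<open>pi/2\<close>. The function \<open>arccos\<close> covers the
  angles in \<open>[0, pi]\<close>; the remaining ones are reached by the symmetry of \<open>kappa\<close>.\<close>

definition psi :: "real \<Rightarrow> real" where
  "psi \<alpha> = (if \<alpha> = 0 then pi / 2 else kappa (arccos \<alpha>) / \<alpha>)"

lemma kappa_K: "(2*pi)\<^sup>2 * K (h / (2*pi)) = kappa h"
  by (simp add: K_def kappa_def field_simps power2_eq_square)

lemma kappa_reflect: "kappa (2*pi - h) = kappa h"
  by (simp add: kappa_def field_simps power2_eq_square)

lemma psi_cos:
  assumes "0 \<le> h" "h \<le> 2*pi"
  shows "psi (cos h) * cos h = kappa h"
proof -
  have half: "psi (cos h) * cos h = kappa h" if "0 \<le> h" "h \<le> pi" for h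
  proof (cases "cos h = 0")
    case True
    then have "h = pi / 2"
      using that by (metis arccos_0 arccos_cos)
    have "kappa (pi/2) = 0"
      by (simp add: kappa_def power2_eq_square)
    then show ?thesis
      unfolding \<open>h = pi/2\<close> by simp
  next
    case False
    with that show ?thesis by (simp add: psi_def arccos_cos)
  qed
  show ?thesis
  proof (cases "h \<le> pi")
    case False
    have "cos (2*pi - h) = cos h"
      by (simp add: cos_diff)
    with half[of "2*pi - h"] assms False show ?thesis
      by (simp add: kappa_reflect)
  qed (use half assms in auto)
qed

text \<open>With \<open>h = pi/2 - x\<close> both the zero of \<open>kappa\<close> and that of the cosine move to the origin, which
  makes regularity and monotonicity accessible.\<close>

lemma psi_sin:
  assumes "-(pi/2) \<le> x" "x \<le> pi/2" "x \<noteq> 0"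
  shows "psi (sin x) = x * (x + pi) / (2 * sin x)" and "sin x \<noteq> 0"
proof -
  show nz: "sin x \<noteq> 0"
    using assms sin_inj_pi[of x 0] by auto
  have "psi (sin x) * sin x = kappa (pi/2 - x)"
    using psi_cos[of "pi/2 - x"] assms by (simp add: cos_sin_eq)
  also have "\<dots> = x * (x + pi) / 2"
    by (simp add: kappa_def field_simps power2_eq_square)
  finally show "psi (sin x) = x * (x + pi) / (2 * sin x)"
    using nz by (simp add: field_simps)
qed

lemma psi_sin_has_derivative:
  assumes "-(pi/2) < x" "x < pi/2" "x \<noteq> 0"
  shows "((\<lambda>x. psi (sin x)) has_real_derivative
     ((2*x + pi) * sin x - x * (x + pi) * cos x) / (2 * (sin x)\<^sup>2)) (at x)"
proof -
  define S where "S = (if x < 0 then {-(pi/2)<..<0} else {0<..<pi/2})"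
  have S: "open S" "x \<in> S" "\<And>y. y \<in> S \<Longrightarrow> -(pi/2) \<le> y \<and> y \<le> pi/2 \<and> y \<noteq> 0"
    using assms by (auto simp: S_def split: if_splits)
  have "((\<lambda>x. x * (x + pi) / (2 * sin x)) has_real_derivative
     ((2*x + pi) * sin x - x * (x + pi) * cos x) / (2 * (sin x)\<^sup>2)) (at x)"
    using psi_sin(2)[of x] assms
    by (auto intro!: derivative_eq_intros simp: field_simps power2_eq_square)
  then show ?thesis
    by (rule has_field_derivative_transform_within_open[OF _ S(1,2)]) (use S(3) psi_sin(1) in auto)
qed

text \<open>The numerator \<open>N\<close> of the derivative of \<open>\<psi> (sin x)\<close> satisfies \<open>N' = (x\<^sup>2 + pi*x + 2) * sin x\<close> and
  vanishes at \<open>0\<close> and \<open>-pi/2\<close>. It increases on the positive side. On \<open>[-pi/2, 0]\<close> the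
  quadratic factor is increasing, negative first and positive afterwards, so \<open>N\<close> rises from \<open>0\<close>
  and then falls back to \<open>0\<close>.\<close>

lemma psi_slope_pos:
  assumes "-(pi/2) < x" "x < pi/2" "x \<noteq> 0"
  shows "0 < (2*x + pi) * sin x - x * (x + pi) * cos x"
proof -
  define N where "N x = (2*x + pi) * sin x - x * (x + pi) * cos x" for x :: real
  define q where "q x = x\<^sup>2 + pi * x + 2" for x :: real
  have N': "(N has_real_derivative q x * sin x) (at x)" for x
    unfolding N_def q_def by (auto intro!: derivative_eq_intros simp: algebra_simps power2_eq_square)
  have cont: "continuous_on S N" for S
    unfolding N_def by (intro continuous_intros)
  have N0: "N 0 = 0" "N (-(pi/2)) = 0"
    by (simp_all add: N_def field_simps)
  have q_mono: "q x < q y" if "-(pi/2) \<le> x" "x < y" for x y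
  proof -
    have "0 < (y - x) * (y + x + pi)"
      using that by (intro mult_pos_pos) auto
    then show ?thesis by (simp add: q_def algebra_simps power2_eq_square)
  qed
  have "0 < N x"
  proof (cases "0 < x")
    case True
    have "N 0 < N x"
    proof (rule DERIV_pos_imp_increasing_open[OF True _ cont])
      fix y assume "0 < y" "y < x"
      then have "0 < q y" "0 < sin y"
        using assms by (auto simp: q_def intro!: sin_gt_zero add_pos_pos mult_pos_pos)
      then show "\<exists>D. (N has_real_derivative D) (at y) \<and> 0 < D"
        by (intro exI[of _ "q y * sin y"] conjI N' mult_pos_pos)
    qed
    then show ?thesis by (simp add: N0)
  next
    case False
    with assms have x: "x < 0" by simp
    have sin_neg: "sin y < 0" if "-(pi/2) < y" "y < 0" for y
      using sin_gt_zero[of "-y"] that by auto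
    show ?thesis
    proof (cases "0 \<le> q x")
      case True
      have "N x > N 0"
      proof (rule DERIV_neg_imp_decreasing_open[OF x _ cont])
        fix y assume "x < y" "y < 0"
        then have "0 < q y" "sin y < 0"
          using q_mono[of x y] True assms sin_neg[of y] by auto
        then show "\<exists>D. (N has_real_derivative D) (at y) \<and> D < 0"
          by (intro exI[of _ "q y * sin y"] conjI N' mult_pos_neg)
      qed
      then show ?thesis by (simp add: N0)
    next
      case False
      have "N (-(pi/2)) < N x"
      proof (rule DERIV_pos_imp_increasing_open[OF _ _ cont])
        fix y assume "-(pi/2) < y" "y < x"
        then have "q y < 0" "sin y < 0"
          using q_mono[of y x] False x sin_neg[of y] by auto
        then show "\<exists>D. (N has_real_derivative D) (at y) \<and> 0 < D"
          by (intro exI[of _ "q y * sin y"] conjI N' mult_neg_neg)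
      qed (use assms in auto)
      then show ?thesis by (simp add: N0)
    qed
  qed
  then show ?thesis by (simp add: N_def)
qed

text \<open>The zero of the sine cancels against the factor \<open>x\<close>: \<open>\<psi> (sin x) = (x + pi) / (2 * sinc x)\<close>.\<close>

lemma psi_sin_continuous: "continuous_on {-(pi/2)..pi/2} (\<lambda>x. psi (sin x))"
proof -
  define sinc where "sinc x = (if x = 0 then 1 else sin x / x)" for x :: real
  have "((\<lambda>x. sin x / x) \<longlongrightarrow> 1) (at (0::real))"
    using DERIV_sin[of "0::real"] by (simp add: DERIV_def)
  then have "isCont sinc 0"
    by (simp add: isCont_def sinc_def cong: LIM_cong)
  moreover have "isCont sinc x" if "x \<noteq> 0" for x
  proof -
    have "isCont (\<lambda>x. sin x / x) x"
      using that by (intro continuous_intros)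
    moreover have "\<forall>\<^sub>F y in nhds x. y \<in> - {0}"
      using that by (intro eventually_nhds_in_open) auto
    then have "\<forall>\<^sub>F y in nhds x. sinc y = sin y / y"
      by eventually_elim (simp add: sinc_def)
    ultimately show ?thesis
      by (simp add: isCont_cong)
  qed
  ultimately have "isCont sinc x" for x
    by (cases "x = 0") auto
  then have cont: "continuous_on S sinc" for S
    by (simp add: continuous_at_imp_continuous_on)
  have nz: "sinc x \<noteq> 0" if "x \<in> {-(pi/2)..pi/2}" for x
    using psi_sin(2)[of x] that by (auto simp: sinc_def)
  have "continuous_on {-(pi/2)..pi/2} (\<lambda>x. (x + pi) / (2 * sinc x))"
    using nz by (intro continuous_intros cont) auto
  then show ?thesis
  proof (rule continuous_on_eq)
    fix x :: real assume "x \<in> {-(pi/2)..pi/2}"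
    then show "(x + pi) / (2 * sinc x) = psi (sin x)"
      by (cases "x = 0") (simp_all add: psi_sin sinc_def, simp add: psi_def)
  qed
qed

lemma psi_sin_strict_mono: 
  assumes "-(pi/2) \<le> x" "x < y" "y \<le> pi/2"
  shows "psi (sin x) < psi (sin y)"
proof -
  have step: "psi (sin a) < psi (sin b)" if "-(pi/2) \<le> a" "a < b" "b \<le> pi/2" "b \<le> 0 \<or> 0 \<le> a" for a b
  proof (rule DERIV_pos_imp_increasing_open[OF \<open>a < b\<close>])
    fix t assume "a < t" "t < b"
    with that have t: "-(pi/2) < t" "t < pi/2" "t \<noteq> 0" by auto
    with psi_sin_has_derivative[OF t] psi_slope_pos[OF t] psi_sin(2)[of t]
    show "\<exists>D. ((\<lambda>x. psi (sin x)) has_real_derivative D) (at t) \<and> 0 < D"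
      by (intro exI conjI) (assumption, auto intro!: divide_pos_pos)
  qed (rule continuous_on_subset[OF psi_sin_continuous], use that in auto)
  show ?thesis
  proof (cases "y \<le> 0 \<or> 0 \<le> x")
    case False
    then have "psi (sin x) < psi (sin 0)" "psi (sin 0) < psi (sin y)"
      using assms by (intro step; auto)+
    then show ?thesis by (rule less_trans)
  qed (use assms step in auto)
qed

lemma psi_strict_mono: "strict_mono_on {-1..1} psi"
proof (rule strict_mono_onI)
  fix a b :: real assume "a \<in> {-1..1}" "b \<in> {-1..1}" "a < b"
  then show "psi a < psi b"
    using psi_sin_strict_mono[of "arcsin a" "arcsin b"] arcsin_bounded[of a] arcsin_bounded[of b]
    by (simp add: arcsin_less_arcsin)
qed

lemma psi_continuous: "continuous_on {-1..1} psi"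
proof -
  have "continuous_on {-1..1} (\<lambda>a. psi (sin (arcsin a)))"
    by (rule continuous_on_compose2[OF psi_sin_continuous continuous_on_arcsin'])
       (use arcsin_bounded in auto)
  then show ?thesis
    by (rule continuous_on_eq) auto
qed

lemma psi_values: "psi (-1) = pi\<^sup>2 / 8" "psi 1 = 3 * pi\<^sup>2 / 8"
  by (simp_all add: psi_def kappa_def power2_eq_square)

lemma psi_bounds:
  assumes "\<alpha> \<in> {-1..1}"
  shows "pi\<^sup>2 / 8 \<le> psi \<alpha>" "psi \<alpha> \<le> 3 * pi\<^sup>2 / 8"
  using strict_mono_on_leD[OF psi_strict_mono, of "-1" \<alpha>] strict_mono_on_leD[OF psi_strict_mono, of \<alpha> 1] assms
  by (auto simp: psi_values)

lemma psi_limit: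
  assumes h: "h \<in> {0..2*pi}" "cos h = 0"
  shows "((\<lambda>s. (2*pi)\<^sup>2 * (K (s / (2*pi)) / cos s)) \<longlongrightarrow> psi (cos h)) (at h)"
proof -
  have h': "0 < h" "h < 2*pi"
    using h by (auto simp: less_le)
  have "continuous_on UNIV (\<lambda>s. psi (cos s))"
    by (rule continuous_on_compose2[OF psi_continuous]) (auto intro: continuous_intros)
  then have "((\<lambda>s. psi (cos s)) \<longlongrightarrow> psi (cos h)) (at h)"
    by (simp add: continuous_on_eq_continuous_at isCont_def)
  moreover have "\<forall>\<^sub>F s in at h. psi (cos s) = (2*pi)\<^sup>2 * (K (s / (2*pi)) / cos s)"
  proof -
    have "\<forall>\<^sub>F s in at h. s \<in> ({0<..<2*pi} - ({pi/2, 3*pi/2} - {h})) - {h}"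
      by (rule eventually_at_in_open) (use h' in \<open>auto intro!: open_Diff finite_imp_closed\<close>)
    then show ?thesis
    proof eventually_elim
      case (elim s)
      \<comment> \<open>the cosine can vanish near \<open>h\<close> only at a zero of \<open>kappa\<close>, and those are isolated\<close>
      have "kappa s = (s - pi/2) * (s - 3*pi/2) / 2"
        by (simp add: kappa_def field_simps power2_eq_square)
      with elim have "kappa s \<noteq> 0"
        by auto
      with elim psi_cos[of s] show ?case
        unfolding times_divide_eq_right kappa_K by (auto simp: eq_divide_eq)
    qed
  qed
  ultimately show ?thesis
    by (rule Lim_transform_eventually)
qed

section \<open>Two integrations by parts\<close>

lemma kappa_has_derivative:
  assumes "(g has_real_derivative g') (at x within S)"
  shows "((\<lambda>x. kappa (g x)) has_real_derivative (g x - pi) * g') (at x within S)"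
  unfolding kappa_def by (auto intro!: derivative_eq_intros assms simp: algebra_simps)

text \<open>First integration by parts, in \<open>t\<close>. The kernel has a corner at \<open>t = s\<close>, so it is done on
  \<open>[0, s]\<close> and on \<open>[s, 2*pi]\<close>; the jump of the slope at the corner produces the term
  \<open>-2*pi * W s\<close>, and the boundary terms at \<open>0\<close> and \<open>2*pi\<close> cancel by periodicity and the symmetry
  of \<open>kappa\<close>.\<close>

lemma covariance_kernel_inner:
  fixes v v' :: "real \<Rightarrow> real"
  defines "W \<equiv> \<lambda>s. integral {0..s} v" and "M \<equiv> \<lambda>s. integral {0..s} (\<lambda>t. t * v t)"
  assumes v: "\<And>t. (v has_real_derivative v' t) (at t)"
    and per: "v (2*pi) = v 0" and s: "s \<in> {0..2*pi}"
  shows "((\<lambda>t. kappa \<bar>s - t\<bar> * v' t) has_integral (s * W (2*pi) - 2*pi * W s + (pi * W (2*pi) - M (2*pi)))) {0..2*pi}"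
proof -
  have cont: "continuous_on S v" for S
    using v by (meson DERIV_isCont continuous_at_imp_continuous_on)
  have W: "(W has_real_derivative v t) (at t within {0..2*pi})" 
    and M: "(M has_real_derivative t * v t) (at t within {0..2*pi})" if "t \<in> {0..2*pi}" for t
    unfolding W_def M_def using that by (auto intro!: integral_has_real_derivative continuous_intros cont)
  have zero: "W 0 = 0" "M 0 = 0" by (simp_all add: W_def M_def)
  \<comment> \<open>antiderivatives of \<open>kappa \<bar>s - t\<bar> * v' t\<close> to the left and right of \<open>s\<close>, from \<open>kappa' h = h - pi\<close>\<close>
  define F1 where "F1 t = kappa (s - t) * v t + (s - pi) * W t - M t" for t
  define F2 where "F2 t = kappa (t - s) * v t + (s + pi) * W t - M t" for t
  have "((\<lambda>t. kappa \<bar>s - t\<bar> * v' t) has_integral (F1 s - F1 0)) {0..s}"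
  proof (rule fundamental_theorem_of_calculus)
    fix t assume t: "t \<in> {0..s}"
    have t': "t \<in> {0..2*pi}" and abs: "\<bar>s - t\<bar> = s - t"
      using t s by auto
    have "(F1 has_real_derivative kappa \<bar>s - t\<bar> * v' t) (at t within {0..2*pi})"
      unfolding F1_def abs
      by (rule derivative_eq_intros kappa_has_derivative refl W[OF t'] M[OF t'] DERIV_subset[OF v] subset_UNIV)+
        (simp add: algebra_simps power2_eq_square)
    then show "(F1 has_vector_derivative kappa \<bar>s - t\<bar> * v' t) (at t within {0..s})"
      using s by (auto simp: has_real_derivative_iff_has_vector_derivative intro: has_vector_derivative_within_subset)
  qed (use s in auto)
  moreover have "((\<lambda>t. kappa \<bar>s - t\<bar> * v' t) has_integral (F2 (2*pi) - F2 s)) {s..2*pi}"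
  proof (rule fundamental_theorem_of_calculus)
    fix t assume t: "t \<in> {s..2*pi}"
    have t': "t \<in> {0..2*pi}" and abs: "\<bar>s - t\<bar> = t - s"
      using t s by auto
    have "(F2 has_real_derivative kappa \<bar>s - t\<bar> * v' t) (at t within {0..2*pi})"
      unfolding F2_def abs
      by (rule derivative_eq_intros kappa_has_derivative refl W[OF t'] M[OF t'] DERIV_subset[OF v] subset_UNIV)+
        (simp add: algebra_simps power2_eq_square)
    then show "(F2 has_vector_derivative kappa \<bar>s - t\<bar> * v' t) (at t within {s..2*pi})"
      using s by (auto simp: has_real_derivative_iff_has_vector_derivative intro: has_vector_derivative_within_subset)
  qed (use s in auto)
  ultimately have "((\<lambda>t. kappa \<bar>s - t\<bar> * v' t) has_integral (F1 s - F1 0 + (F2 (2*pi) - F2 s))) {0..2*pi}"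
    using s by (intro has_integral_combine[of 0 s "2*pi"]) auto
  moreover have "F1 s - F1 0 + (F2 (2*pi) - F2 s) = s * W (2*pi) - 2*pi * W s + (pi * W (2*pi) - M (2*pi))"
    unfolding F1_def F2_def kappa_reflect zero per by (simp add: algebra_simps)
  ultimately show ?thesis by simp
qed

text \<open>Second integration by parts, in \<open>s\<close>. The factor of \<open>u' s\<close> takes the same value \<open>C\<close> at both ends
  of the period, so the boundary terms cancel.\<close>

lemma covariance_kernel_outer:
  fixes u u' v :: "real \<Rightarrow> real"
  defines "W \<equiv> \<lambda>s. integral {0..s} v"
  assumes u: "\<And>t. (u has_real_derivative u' t) (at t)" and v: "continuous_on {0..2*pi} v"
    and per: "u (2*pi) = u 0"
  shows "((\<lambda>s. u' s * (s * W (2*pi) - 2*pi * W s + C)) has_integral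
     (2*pi * integral {0..2*pi} (\<lambda>t. u t * v t) - integral {0..2*pi} u * W (2*pi))) {0..2*pi}"
proof -
  have cont: "continuous_on S u" for S
    using u by (meson DERIV_isCont continuous_at_imp_continuous_on)
  define U where "U s = integral {0..s} u" for s
  define P where "P s = integral {0..s} (\<lambda>t. u t * v t)" for s
  have W: "(W has_real_derivative v t) (at t within {0..2*pi})" 
    and U: "(U has_real_derivative u t) (at t within {0..2*pi})" 
    and P: "(P has_real_derivative u t * v t) (at t within {0..2*pi})" if "t \<in> {0..2*pi}" for t
    unfolding W_def U_def P_def using that by (auto intro!: integral_has_real_derivative continuous_intros cont v)
  have zero: "W 0 = 0" "U 0 = 0" "P 0 = 0" by (simp_all add: W_def U_def P_def)
  \<comment> \<open>the product rule leaves \<open>u s * (W (2*pi) - 2*pi * v s)\<close>, which \<open>U\<close> and \<open>P\<close> compensate\<close>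
  define G where "G s = u s * (s * W (2*pi) - 2*pi * W s + C) - W (2*pi) * U s + 2*pi * P s" for s
  have "((\<lambda>s. u' s * (s * W (2*pi) - 2*pi * W s + C)) has_integral (G (2*pi) - G 0)) {0..2*pi}"
  proof (rule fundamental_theorem_of_calculus)
    fix s :: real assume s: "s \<in> {0..2*pi}"
    have "(G has_real_derivative u' s * (s * W (2*pi) - 2*pi * W s + C)) (at s within {0..2*pi})"
      unfolding G_def
      by (rule derivative_eq_intros refl W[OF s] U[OF s] P[OF s] DERIV_subset[OF u] subset_UNIV)+
        (simp add: algebra_simps)
    then show "(G has_vector_derivative u' s * (s * W (2*pi) - 2*pi * W s + C)) (at s within {0..2*pi})"
      by (simp add: has_real_derivative_iff_has_vector_derivative)
  qed auto
  moreover have "G (2*pi) - G 0 = 2*pi * P (2*pi) - U (2*pi) * W (2*pi)"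
    unfolding G_def zero per by (simp add: algebra_simps)
  ultimately show ?thesis by (simp add: U_def P_def)
qed

section \<open>Existence\<close>

lemma borel_measurable_sigma1:
  fixes f :: "real^2 \<Rightarrow> 'b::topological_space"
  assumes "continuous_on circle f"
  shows "f \<in> borel_measurable sigma1"
  using borel_measurable_continuous_on_restrict[OF assms] by (simp cong: measurable_cong_sets)

lemma inner_torus_measurable [measurable]: "(\<lambda>(x, y). x \<bullet> y) \<in> borel_measurable torus_measure"
proof -
  have [measurable]: "(\<lambda>x. x) \<in> borel_measurable sigma1"
    by (rule borel_measurable_sigma1) (rule continuous_on_id)
  have "fst \<in> borel_measurable torus_measure" "snd \<in> borel_measurable torus_measure"
    using measurable_compose[OF measurable_fst, of "\<lambda>x. x" sigma1 borel sigma1]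
      measurable_compose[OF measurable_snd, of "\<lambda>x. x" sigma1 borel sigma1] by simp_all
  then show ?thesis
    unfolding case_prod_beta by (rule borel_measurable_inner)
qed

lemma inner_circle_bounds:
  assumes "x \<in> circle" "y \<in> circle"
  shows "x \<bullet> y \<in> {-1..1}"
  using Cauchy_Schwarz_ineq2[of x y] assms by auto

lemma inner_torus_bounds:
  assumes "z \<in> space torus_measure"
  shows "(case z of (x, y) \<Rightarrow> x \<bullet> y) \<in> {-1..1}"
  using assms inner_circle_bounds by (auto simp: space_pair_measure simp del: atLeastAtMost_iff)

lemma continuous_inner_torus_measurable:
  fixes F :: "real \<Rightarrow> real"
  assumes "continuous_on {-1..1} F"
  shows "(\<lambda>(x, y). F (x \<bullet> y)) \<in> borel_measurable torus_measure"
proof -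
  have "(\<lambda>(x, y). x \<bullet> y) \<in> torus_measure \<rightarrow>\<^sub>M restrict_space borel {-1..1}"
    using inner_torus_bounds by (intro measurable_restrict_space2) auto
  from measurable_compose[OF this borel_measurable_continuous_on_restrict[OF assms]]
  show ?thesis by (simp add: case_prod_beta)
qed

lemma psi_torus_integrable: "integrable torus_measure (\<lambda>(x, y). psi (x \<bullet> y))"
proof (rule torus.integrable_const_bound[where B="3 * pi\<^sup>2 / 8"])
  show "AE z in torus_measure. norm (case z of (x, y) \<Rightarrow> psi (x \<bullet> y)) \<le> 3 * pi\<^sup>2 / 8"
  proof (rule AE_I2)
    fix z assume "z \<in> space torus_measure"
    from psi_bounds[OF inner_torus_bounds[OF this]]
    show "norm (case z of (x, y) \<Rightarrow> psi (x \<bullet> y)) \<le> 3 * pi\<^sup>2 / 8"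
      using pi_gt_zero by (auto simp: case_prod_beta intro: order_trans[of "-_" 0])
  qed
qed (rule continuous_inner_torus_measurable[OF psi_continuous])

text \<open>The gradients are continuous on the compact circle, hence bounded.\<close>

lemma gradient_product_integrable:
  assumes p: "integrable torus_measure p" and f: "C1_on_circle f" and g: "C1_on_circle g"
  shows "(\<lambda>(x, y). spherical_gradient f x \<bullet> spherical_gradient g y) \<in> borel_measurable torus_measure"
    and "integrable torus_measure (\<lambda>z. p z * (case z of (x, y) \<Rightarrow> spherical_gradient f x \<bullet> spherical_gradient g y))"
proof -
  have bounded: "\<exists>B. \<forall>x\<in>circle. norm (spherical_gradient h x) \<le> B" if "C1_on_circle h" for h
    using compact_imp_bounded[OF compact_continuous_image[of circle "spherical_gradient h"]] that
    by (auto simp: C1_on_circle_def bounded_iff)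
  obtain A B where A: "\<And>x. x \<in> circle \<Longrightarrow> norm (spherical_gradient f x) \<le> A"
    and B: "\<And>x. x \<in> circle \<Longrightarrow> norm (spherical_gradient g x) \<le> B"
    using bounded[OF f] bounded[OF g] by blast
  have [measurable]: "spherical_gradient f \<in> borel_measurable sigma1" "spherical_gradient g \<in> borel_measurable sigma1"
    using f g by (auto intro!: borel_measurable_sigma1 simp: C1_on_circle_def)
  show meas [measurable]: "(\<lambda>(x, y). spherical_gradient f x \<bullet> spherical_gradient g y) \<in> borel_measurable torus_measure"
    by measurable
  have "integrable torus_measure (\<lambda>z. p z * (A * B))"
    using p by auto
  moreover have "AE z in torus_measure. norm (p z * (case z of (x, y) \<Rightarrow> spherical_gradient f x \<bullet> spherical_gradient g y))
      \<le> norm (p z * (A * B))"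
  proof (rule AE_I2)
    fix z assume "z \<in> space torus_measure"
    then obtain x y where z: "z = (x, y)" and xy: "x \<in> circle" "y \<in> circle"
      by (cases z) (simp add: space_pair_measure)
    have "\<bar>spherical_gradient f x \<bullet> spherical_gradient g y\<bar> \<le> norm (spherical_gradient f x) * norm (spherical_gradient g y)"
      by (rule Cauchy_Schwarz_ineq2)
    also have "\<dots> \<le> A * B"
      using A[OF xy(1)] B[OF xy(2)] norm_ge_zero[of "spherical_gradient f x"] by (intro mult_mono) (auto intro: order_trans[OF norm_ge_zero])
    also have "\<dots> \<le> \<bar>A * B\<bar>"
      by (rule abs_ge_self)
    finally show "norm (p z * (case z of (x, y) \<Rightarrow> spherical_gradient f x \<bullet> spherical_gradient g y)) \<le> norm (p z * (A * B))"
      unfolding z real_norm_def prod.case abs_mult[of "p (x, y)"]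
      by (intro mult_left_mono abs_ge_zero) simp
  qed
  ultimately show "integrable torus_measure (\<lambda>z. p z * (case z of (x, y) \<Rightarrow> spherical_gradient f x \<bullet> spherical_gradient g y))"
    by (rule Bochner_Integration.integrable_bound[OF _ borel_measurable_times[OF borel_measurable_integrable[OF p] meas]])
qed

lemma C1_imp_measurable:
  assumes "C1_on_circle f" shows "f \<in> borel_measurable sigma1"
  using assms by (auto intro!: borel_measurable_sigma1 differentiable_imp_continuous_on simp: C1_on_circle_def)

text \<open>In angles the integrand is \<open>u' s * v' t * kappa \<bar>s - t\<bar>\<close>, and Fubini reduces the claim to the
  two integrations by parts; each of the two circle integrals contributes a factor \<open>1/(2*pi)\<close>.\<close>

lemma covariance_psi:
  assumes f: "C1_on_circle f" and g: "C1_on_circle g"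
  shows "covariance sigma1 f g =
    (\<integral>z. (case z of (x, y) \<Rightarrow> psi (x \<bullet> y)) * (case z of (x, y) \<Rightarrow> spherical_gradient f x \<bullet> spherical_gradient g y) \<partial>torus_measure)"
proof -
  define u v where "u t = f (circ t)" and "v t = g (circ t)" for t
  obtain u' where u: "\<And>t. (u has_real_derivative u' t) (at t)"
    and gu: "\<And>t. spherical_gradient f (circ t) = u' t *\<^sub>R tang t" and cu': "continuous_on UNIV u'"
    using C1_on_circle_chart[OF f] unfolding u_def[abs_def] by metis
  obtain v' where v: "\<And>t. (v has_real_derivative v' t) (at t)"
    and gv: "\<And>t. spherical_gradient g (circ t) = v' t *\<^sub>R tang t" and cv': "continuous_on UNIV v'"
    using C1_on_circle_chart[OF g] unfolding v_def[abs_def] by metis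
  have cu: "continuous_on S u" and cv: "continuous_on S v" for S
    using u v by (meson DERIV_isCont continuous_at_imp_continuous_on)+
  have cu'S: "continuous_on S u'" and cv'S: "continuous_on S v'" for S
    using cu' cv' continuous_on_subset by blast+
  have "circ (2*pi) = circ 0" by (simp add: circ_def)
  then have per: "u (2*pi) = u 0" "v (2*pi) = v 0" by (simp_all add: u_def v_def)
  note meas [measurable] = C1_imp_measurable[OF f] C1_imp_measurable[OF g]
  define W where "W s = integral {0..s} v" for s
  define C where "C = pi * W (2*pi) - integral {0..2*pi} (\<lambda>t. t * v t)"
  have cW: "continuous_on {0..2*pi} W"
    unfolding W_def by (rule indefinite_integral_continuous_1) (rule integrable_continuous_real, rule cv)
  let ?F = "\<lambda>x y. psi (x \<bullet> y) * (spherical_gradient f x \<bullet> spherical_gradient g y)"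
  have int: "integrable torus_measure (\<lambda>(x, y). ?F x y)"
    using gradient_product_integrable(2)[OF psi_torus_integrable f g] by (simp add: case_prod_unfold)
  have inner: "(\<integral>y. ?F (circ s) y \<partial>sigma1) = u' s * (s * W (2*pi) - 2*pi * W s + C) / (2*pi)"
    if s: "s \<in> {0..2*pi}" for s
  proof -
    have eq: "?F (circ s) (circ t) = u' s * (kappa \<bar>s - t\<bar> * v' t)" if "t \<in> {0..2*pi}" for t
    proof -
      have "psi (cos (s - t)) * cos (s - t) = kappa \<bar>s - t\<bar>"
        using psi_cos[of "\<bar>s - t\<bar>"] s that by auto
      then show ?thesis
        by (simp add: gu gv inner_circ inner_tang ac_simps)
    qed
    have "(\<lambda>y. ?F (circ s) y) \<in> borel_measurable sigma1"
      using borel_measurable_integrable[OF int] circ_in_circle by (auto intro: measurable_Pair2[of "\<lambda>(x, y). ?F x y"])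
    moreover have "continuous_on {0..2*pi} (\<lambda>t. ?F (circ s) (circ t))"
    proof -
      have "continuous_on {0..2*pi} (\<lambda>t. u' s * (kappa \<bar>s - t\<bar> * v' t))"
        unfolding kappa_def by (intro continuous_intros cv'S) auto
      then show ?thesis by (rule continuous_on_eq) (simp only: eq)
    qed
    ultimately have "(\<integral>y. ?F (circ s) y \<partial>sigma1) = integral {0..2*pi} (\<lambda>t. ?F (circ s) (circ t)) / (2*pi)"
      by (rule integral_sigma1_continuous)
    also have "integral {0..2*pi} (\<lambda>t. ?F (circ s) (circ t)) = integral {0..2*pi} (\<lambda>t. u' s * (kappa \<bar>s - t\<bar> * v' t))"
      by (rule Henstock_Kurzweil_Integration.integral_cong) (rule eq)
    also have "\<dots> = u' s * (s * W (2*pi) - 2*pi * W s + C)"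
      using has_integral_mult_right[OF covariance_kernel_inner[OF v per(2) s]]
      unfolding W_def C_def by (rule integral_unique)
    finally show ?thesis .
  qed
  have "(\<integral>z. (case z of (x, y) \<Rightarrow> psi (x \<bullet> y)) * (case z of (x, y) \<Rightarrow> spherical_gradient f x \<bullet> spherical_gradient g y) \<partial>torus_measure)
      = (\<integral>z. (case z of (x, y) \<Rightarrow> ?F x y) \<partial>torus_measure)"
    by (simp add: case_prod_beta)
  also have "\<dots> = (\<integral>x. (\<integral>y. ?F x y \<partial>sigma1) \<partial>sigma1)"
    using torus.integral_fst'[OF int] by simp
  also have "\<dots> = integral {0..2*pi} (\<lambda>s. \<integral>y. ?F (circ s) y \<partial>sigma1) / (2*pi)"
  proof (rule integral_sigma1_continuous)
    show "(\<lambda>x. \<integral>y. ?F x y \<partial>sigma1) \<in> borel_measurable sigma1"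
      using borel_measurable_integrable[OF torus.integrable_fst'[OF int]] by simp
    have "continuous_on {0..2*pi} (\<lambda>s. u' s * (s * W (2*pi) - 2*pi * W s + C))"
      by (intro continuous_intros cu'S cW)
    from continuous_on_mult_right[OF this, of "1 / (2*pi)"]
    show "continuous_on {0..2*pi} (\<lambda>s. \<integral>y. ?F (circ s) y \<partial>sigma1)"
      by (rule continuous_on_eq) (simp only: inner times_divide_eq_right mult_1_right)
  qed
  also have "integral {0..2*pi} (\<lambda>s. \<integral>y. ?F (circ s) y \<partial>sigma1)
      = integral {0..2*pi} (\<lambda>s. u' s * (s * W (2*pi) - 2*pi * W s + C) / (2*pi))"
    by (rule Henstock_Kurzweil_Integration.integral_cong) (rule inner)
  also have "\<dots> = (2*pi * integral {0..2*pi} (\<lambda>t. u t * v t) - integral {0..2*pi} u * W (2*pi)) / (2*pi)"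
    using has_integral_divide[OF covariance_kernel_outer[OF u cv per(1)], of C "2*pi"]
    unfolding W_def by (rule integral_unique)
  also have "\<dots> / (2*pi) = covariance sigma1 f g"
  proof -
    have "(\<integral>x. f x * g x \<partial>sigma1) = integral {0..2*pi} (\<lambda>t. u t * v t) / (2*pi)"
      unfolding u_def v_def
      by (rule integral_sigma1_continuous) (measurable, auto intro!: continuous_intros cu[unfolded u_def] cv[unfolded v_def])
    moreover have "(\<integral>x. f x \<partial>sigma1) = integral {0..2*pi} u / (2*pi)"
      unfolding u_def
      by (rule integral_sigma1_continuous) (measurable, rule cu[unfolded u_def])
    moreover have "(\<integral>x. g x \<partial>sigma1) = integral {0..2*pi} v / (2*pi)"
      unfolding v_def
      by (rule integral_sigma1_continuous) (measurable, rule cv[unfolded v_def])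
    moreover have "(2*pi * A - B * C) / (2*pi) / (2*pi) = A / (2*pi) - B / (2*pi) * (C / (2*pi))" for A B C
      by (simp add: field_simps)
    ultimately show ?thesis
      by (simp only: covariance_def W_def)
  qed
  finally show ?thesis ..
qed

definition nu :: "((real^2) \<times> (real^2)) set \<Rightarrow> real" where
  "nu A = (if A \<in> sets torus_measure then LINT z:A|torus_measure. (case z of (x, y) \<Rightarrow> psi (x \<bullet> y)) else 0)"

lemma nu_density: "has_signed_density torus_measure nu (\<lambda>(x, y). psi (x \<bullet> y))"
  using psi_torus_integrable by (simp add: has_signed_density_def nu_def)

lemma nu_represents: "represents_covariance nu"
  unfolding represents_covariance_def
proof (intro conjI exI allI impI)
  show "signed_measure torus_measure nu"
    using signed_measure_density[OF psi_torus_integrable] unfolding nu_def[abs_def] .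
  show "has_signed_density torus_measure nu (\<lambda>(x, y). psi (x \<bullet> y))"
    by (rule nu_density)
  fix f g assume fg: "C1_on_circle f" "C1_on_circle g"
  show "covariance sigma1 f g = signed_integral torus_measure nu (\<lambda>(x, y). spherical_gradient f x \<bullet> spherical_gradient g y)"
    unfolding covariance_psi[OF fg]
    by (rule signed_integral_density[OF nu_density, symmetric]) 
       (rule gradient_product_integrable[OF psi_torus_integrable fg])+
qed

section \<open>Circular harmonics and Chebyshev polynomials\<close>

text \<open>The real parts of the multiples of \<open>z ^ n\<close>. On the circle, \<open>a = 1\<close> gives \<open>cos (n*t)\<close> and
  \<open>a = - \<i>\<close> gives \<open>sin (n*t)\<close>.\<close>

definition harmonic :: "complex \<Rightarrow> nat \<Rightarrow> real^2 \<Rightarrow> real" where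
  "harmonic a n x = Re (a * (of_real (x $ 1) + \<i> * of_real (x $ 2)) ^ n)"

lemma harmonic_circ: "harmonic a n (circ t) = Re a * cos (n * t) - Im a * sin (n * t)"
proof -
  have "of_real (cos t) + \<i> * of_real (sin t) = cis t"
    by (simp add: complex_eq_iff)
  then show ?thesis
    by (simp add: harmonic_def Complex.DeMoivre)
qed

lemma harmonic_circ_deriv:
  "((\<lambda>t. harmonic a n (circ t)) has_real_derivative - n * (Re a * sin (n * t) + Im a * cos (n * t))) (at t)"
  unfolding harmonic_circ by (auto intro!: derivative_eq_intros simp: algebra_simps)

lemma harmonic_differentiable: "harmonic a n differentiable (at x within S)"
proof -
  have "bounded_linear (\<lambda>x::real^2. complex_of_real (x $ 1) + \<i> * of_real (x $ 2))"
    by (intro bounded_linear_add bounded_linear_compose[OF bounded_linear_of_real] bounded_linear_vec_nth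
        bounded_linear_compose[OF bounded_linear_mult_right])
  from bounded_linear_imp_has_derivative[OF this]
  have "((\<lambda>x::real^2. complex_of_real (x $ 1) + \<i> * of_real (x $ 2)) has_derivative
      (\<lambda>x. complex_of_real (x $ 1) + \<i> * of_real (x $ 2))) (at x within S)" .
  from bounded_linear.has_derivative[OF bounded_linear_Re has_derivative_mult_right[OF has_derivative_power[OF this]]]
  show ?thesis
    unfolding differentiable_def harmonic_def[abs_def] by blast
qed

lemma harmonic_gradient:
  "spherical_gradient (harmonic a n) (circ t) = (- n * (Re a * sin (n * t) + Im a * cos (n * t))) *\<^sub>R tang t"
  by (rule spherical_gradient_circ[OF harmonic_differentiable harmonic_circ_deriv])

text \<open>The angular derivative of a harmonic is \<open>-n\<close> times the conjugate harmonic, which is again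
  given by a polynomial formula; this is how continuity of the gradient on the circle is seen.\<close>

lemma harmonic_C1: "C1_on_circle (harmonic a n)"
  unfolding C1_on_circle_def
proof
  show "harmonic a n differentiable_on circle"
    by (simp add: differentiable_on_def harmonic_differentiable)
  have "continuous_on circle (\<lambda>x::real^2. (- n * harmonic (- \<i> * a) n x) *\<^sub>R ((- (x $ 2)) *\<^sub>R axis 1 1 + (x $ 1) *\<^sub>R (axis 2 1 :: real^2)))"
    unfolding harmonic_def by (intro continuous_intros)
  then show "continuous_on circle (spherical_gradient (harmonic a n))"
  proof (rule continuous_on_eq)
    fix x :: "real^2" assume "x \<in> circle"
    then obtain t where "x = circ t" by (rule circle_cases)
    then show "(- n * harmonic (- \<i> * a) n x) *\<^sub>R ((- (x $ 2)) *\<^sub>R axis 1 1 + (x $ 1) *\<^sub>R axis 2 1)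
        = spherical_gradient (harmonic a n) x"
      by (simp add: harmonic_circ harmonic_gradient tang_eq)
  qed
qed

text \<open>Defined by the recursion because the uniqueness proof multiplies by \<open>x\<close>, and the recursion
  expresses \<open>x * chebyshev (Suc n) x\<close> through its two neighbours.\<close>

fun chebyshev :: "nat \<Rightarrow> real \<Rightarrow> real" where
  "chebyshev 0 x = 1"
| "chebyshev (Suc 0) x = x"
| "chebyshev (Suc (Suc n)) x = 2 * x * chebyshev (Suc n) x - chebyshev n x"

lemma chebyshev_cos: "chebyshev n (cos h) = cos (n * h)"
proof (induction n "cos h" rule: chebyshev.induct)
  case (3 n)
  have "cos (real (Suc (Suc n)) * h) = cos (Suc n * h + h)" "cos (real n * h) = cos (Suc n * h - h)"
    by (simp_all add: algebra_simps)
  then show ?case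
    using 3 by (simp only: chebyshev.simps cos_add cos_diff) simp
qed simp_all

lemma chebyshev_continuous: "continuous_on S (chebyshev n)"
proof -
  have "continuous_on S (chebyshev n) \<and> continuous_on S (chebyshev (Suc n))"
  proof (induction n)
    case 0
    show ?case by simp
  next
    case (Suc n)
    then show ?case by (auto intro!: continuous_intros)
  qed
  then show ?thesis ..
qed

text \<open>Summing over the sine and the cosine makes the product of the gradients invariant under rotations,
  by the addition theorem for \<open>cos (n*(s - t))\<close>.\<close>

lemma harmonic_gradients_chebyshev:
  assumes "x \<in> circle" "y \<in> circle"
  shows "spherical_gradient (harmonic 1 n) x \<bullet> spherical_gradient (harmonic 1 n) y
    + spherical_gradient (harmonic (- \<i>) n) x \<bullet> spherical_gradient (harmonic (- \<i>) n) y
    = (real n)\<^sup>2 * ((x \<bullet> y) * chebyshev n (x \<bullet> y))"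
proof -
  obtain s t where xy: "x = circ s" "y = circ t"
    using assms by (metis circle_cases)
  have "chebyshev n (cos (s - t)) = cos (n * (s - t))"
    by (rule chebyshev_cos)
  also have "\<dots> = cos (n * s) * cos (n * t) + sin (n * s) * sin (n * t)"
    by (simp add: right_diff_distrib cos_diff)
  finally show ?thesis
    unfolding xy harmonic_gradient inner_circ
    by (simp add: inner_tang algebra_simps power2_eq_square)
qed

lemma chebyshev_mean_zero:
  assumes "n \<noteq> 0"
  shows "(\<integral>z. (case z of (x, y) \<Rightarrow> chebyshev n (x \<bullet> y)) \<partial>torus_measure) = 0"
proof -
  have bounded: "\<bar>chebyshev n a\<bar> \<le> 1" if "a \<in> {-1..1}" for a
    using chebyshev_cos[of n "arccos a"] that by (simp add: cos_arccos)
  have int: "integrable torus_measure (\<lambda>(x, y). chebyshev n (x \<bullet> y))"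
  proof (rule torus.integrable_const_bound[where B=1])
    show "AE z in torus_measure. norm (case z of (x, y) \<Rightarrow> chebyshev n (x \<bullet> y)) \<le> 1"
      using bounded inner_torus_bounds by (intro AE_I2) (auto simp: case_prod_beta simp del: atLeastAtMost_iff)
  qed (rule continuous_inner_torus_measurable[OF chebyshev_continuous])
  have "(\<integral>y. chebyshev n (x \<bullet> y) \<partial>sigma1) = 0" if "x \<in> circle" for x
  proof -
    obtain s where x: "x = circ s" using \<open>x \<in> circle\<close> by (metis circle_cases)
    have "(\<integral>y. chebyshev n (x \<bullet> y) \<partial>sigma1) = integral {0..2*pi} (\<lambda>t. chebyshev n (x \<bullet> circ t)) / (2*pi)"
    proof (rule integral_sigma1_continuous)
      show "(\<lambda>y. chebyshev n (x \<bullet> y)) \<in> borel_measurable sigma1"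
        by (intro borel_measurable_sigma1 continuous_on_compose2[OF chebyshev_continuous[of UNIV]] continuous_intros) auto
      show "continuous_on {0..2*pi} (\<lambda>t. chebyshev n (x \<bullet> circ t))"
        by (intro continuous_on_compose2[OF chebyshev_continuous[of UNIV]] continuous_intros circ_continuous) auto
    qed
    also have "integral {0..2*pi} (\<lambda>t. chebyshev n (x \<bullet> circ t)) = 0"
    proof (rule integral_unique)
      have "((\<lambda>t. chebyshev n (x \<bullet> circ t)) has_integral (- sin (n * (s - 2*pi)) / n - (- sin (n * (s - 0)) / n))) {0..2*pi}"
        by (rule fundamental_theorem_of_calculus)
           (use assms in \<open>auto intro!: derivative_eq_intros simp: x inner_circ chebyshev_cos
             has_real_derivative_iff_has_vector_derivative[symmetric]\<close>)
      moreover have "sin (n * (s - 2*pi)) = sin (n * s)"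
        using sin_2npi[of n] cos_2npi[of n] by (simp add: right_diff_distrib sin_diff ac_simps)
      ultimately show "((\<lambda>t. chebyshev n (x \<bullet> circ t)) has_integral 0) {0..2*pi}" by simp
    qed
    finally show ?thesis by simp
  qed
  then have "(\<integral>x. (\<integral>y. chebyshev n (x \<bullet> y) \<partial>sigma1) \<partial>sigma1) = (\<integral>x. 0 \<partial>sigma1)"
    by (intro Bochner_Integration.integral_cong) auto
  then show ?thesis
    using torus.integral_fst'[OF int] by simp
qed

section \<open>Moments on a compact interval\<close>

text \<open>A continuous function is bounded on a compact set, hence a harmless factor under an integral.\<close>

lemma integrable_mult_continuous:
  fixes p :: "'a \<Rightarrow> real" and F :: "'b::t2_space \<Rightarrow> real"
  assumes p: "integrable M p" and [measurable]: "X \<in> borel_measurable M"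
    and C: "compact C" "AE z in M. X z \<in> C" and F: "continuous_on UNIV F"
  shows "integrable M (\<lambda>z. p z * F (X z))"
proof -
  have [measurable]: "F \<in> borel_measurable borel"
    using F by (rule borel_measurable_continuous_onI)
  have "bounded (F ` C)"
    by (intro compact_imp_bounded compact_continuous_image C continuous_on_subset[OF F]) simp
  then obtain B where B: "\<And>x. x \<in> C \<Longrightarrow> \<bar>F x\<bar> \<le> B"
    by (auto simp: bounded_iff)
  have "AE z in M. norm (p z * F (X z)) \<le> norm (p z * B)"
    using C(2)
  proof eventually_elim
    case (elim z)
    from B[OF elim] have "\<bar>F (X z)\<bar> \<le> \<bar>B\<bar>" by linarith
    then show ?case
      by (simp add: abs_mult mult_left_mono)
  qed
  then show ?thesis
    by (rule Bochner_Integration.integrable_bound[of _ "\<lambda>z. p z * B", rotated 2]) (use p in auto)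
qed

text \<open>By Weierstrass approximation \<open>w\<close> is orthogonal to all continuous functions; piecewise linear cutoffs
  converge to indicators of rays, and rays form an intersection-stable generator of the Borel sets.\<close>

lemma AE_zero_if_moments_zero:
  fixes w :: "real \<Rightarrow> real"
  assumes N: "sets N = sets borel" and bd: "AE x in N. x \<in> {-1..1}"
    and w: "integrable N w" and moments: "\<And>j. (\<integral>x. w x * x ^ j \<partial>N) = 0"
  shows "AE x in N. w x = 0"
proof -
  note N [measurable_cong]
  have [measurable]: "w \<in> borel_measurable N" using w by simp
  have int: "integrable N (\<lambda>x. w x * F x)" and test: "(\<integral>x. w x * F x \<partial>N) = 0"
    if F: "continuous_on UNIV F" for F :: "real \<Rightarrow> real"
  proof -
    have wint: "integrable N (\<lambda>x. w x * F x)" if F: "continuous_on UNIV F" for F :: "real \<Rightarrow> real"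
      by (rule integrable_mult_continuous[OF w _ compact_Icc bd F]) measurable
    show "integrable N (\<lambda>x. w x * F x)" using F by (rule wint)
    have "\<bar>\<integral>x. w x * F x \<partial>N\<bar> \<le> e * (\<integral>x. \<bar>w x\<bar> \<partial>N)" if "0 < e" for e
    proof -
      obtain g where g: "real_polynomial_function g" "\<And>x. x \<in> {-1..1} \<Longrightarrow> \<bar>F x - g x\<bar> < e"
        using Stone_Weierstrass_real_polynomial_function[OF compact_Icc continuous_on_subset[OF F subset_UNIV] \<open>0 < e\<close>]
        by metis
      obtain a n where ga: "g = (\<lambda>x. \<Sum>i\<le>n. a i * x ^ i)"
        using g(1) unfolding real_polynomial_function_iff_sum by metis
      have "(\<integral>x. w x * g x \<partial>N) = (\<integral>x. (\<Sum>i\<le>n. a i * (w x * x ^ i)) \<partial>N)"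
        by (simp add: ga sum_distrib_left ac_simps)
      also have "\<dots> = (\<Sum>i\<le>n. a i * (\<integral>x. w x * x ^ i \<partial>N))"
        by (subst Bochner_Integration.integral_sum) (auto intro!: wint continuous_intros)
      finally have g0: "(\<integral>x. w x * g x \<partial>N) = 0" by (simp add: moments)
      have gint: "integrable N (\<lambda>x. w x * g x)"
        unfolding ga by (intro wint continuous_intros)
      have "\<bar>\<integral>x. w x * F x \<partial>N\<bar> = \<bar>\<integral>x. w x * F x - w x * g x \<partial>N\<bar>"
        using wint[OF F] gint g0 by simp
      also have "\<dots> \<le> (\<integral>x. \<bar>w x * F x - w x * g x\<bar> \<partial>N)"
        by (rule integral_abs_bound)
      also have "\<dots> \<le> (\<integral>x. e * \<bar>w x\<bar> \<partial>N)"
      proof (rule integral_mono_AE)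
        show "AE x in N. \<bar>w x * F x - w x * g x\<bar> \<le> e * \<bar>w x\<bar>"
          using bd
        proof eventually_elim
          case (elim x)
          then have "\<bar>w x\<bar> * \<bar>F x - g x\<bar> \<le> \<bar>w x\<bar> * e"
            using g(2)[of x] by (intro mult_left_mono) auto
          then show ?case
            by (simp add: abs_mult[symmetric] right_diff_distrib mult.commute)
        qed
      qed (use wint[OF F] gint w in auto)
      finally show ?thesis by simp
    qed
    note small = this
    have "\<bar>\<integral>x. w x * F x \<partial>N\<bar> \<le> 0"
    proof (rule field_le_epsilon)
      fix d :: real assume "0 < d"
      define I where "I = (\<integral>x. \<bar>w x\<bar> \<partial>N)"
      have "0 \<le> I" unfolding I_def by simp
      \<comment> \<open>dividing by \<open>I + 1\<close> instead of \<open>I\<close> avoids the case \<open>I = 0\<close>\<close>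
      have "\<bar>\<integral>x. w x * F x \<partial>N\<bar> \<le> d / (I + 1) * I"
        unfolding I_def by (rule small) (use \<open>0 < d\<close> \<open>0 \<le> I\<close> in \<open>auto simp: I_def[symmetric]\<close>)
      also have "\<dots> \<le> d"
        using \<open>0 < d\<close> \<open>0 \<le> I\<close> by (simp add: field_simps)
      finally show "\<bar>\<integral>x. w x * F x \<partial>N\<bar> \<le> 0 + d" by simp
    qed
    then show "(\<integral>x. w x * F x \<partial>N) = 0" by simp
  qed
  have ray: "(LINT x:{..a}|N. w x) = 0" for a
  proof -
    \<comment> \<open>the value is \<open>1\<close> up to \<open>a\<close> and falls linearly to \<open>0\<close> at \<open>a + 1/k\<close>\<close>
    define F where "F k x = max 0 (min 1 (1 - real k * (x - a)))" for k x
    have cF: "continuous_on UNIV (F k)" for k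
      unfolding F_def by (intro continuous_intros)
    have [measurable]: "F k \<in> borel_measurable borel" for k
      using cF by (rule borel_measurable_continuous_onI)
    have lim: "(\<lambda>k. F k x) \<longlonglongrightarrow> indicator {..a} x" for x
    proof (cases "x \<le> a")
      case True
      then have "F k x = 1" for k
        by (simp add: F_def mult_nonneg_nonpos)
      with True show ?thesis by simp
    next
      case False
      obtain k0 :: nat where "1 / (x - a) < k0" using reals_Archimedean2 by blast
      have "F k x = 0" if "k \<ge> k0" for k
      proof -
        have "1 / (x - a) \<le> k" using \<open>1 / (x - a) < k0\<close> that by linarith
        then have "1 \<le> k * (x - a)" using False by (simp add: field_simps)
        then show ?thesis by (simp add: F_def)
      qed
      then have "\<forall>\<^sub>F k in sequentially. F k x = indicator {..a} x"
        using False by (auto simp: eventually_sequentially)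
      then show ?thesis by (rule tendsto_eventually)
    qed
    have "(\<lambda>k. \<integral>x. w x * F k x \<partial>N) \<longlonglongrightarrow> (\<integral>x. w x * indicator {..a} x \<partial>N)"
    proof (rule integral_dominated_convergence[where w="\<lambda>x. \<bar>w x\<bar>"])
      show "AE x in N. (\<lambda>k. w x * F k x) \<longlonglongrightarrow> w x * indicator {..a} x"
        using lim by (auto intro!: tendsto_mult)
      show "AE x in N. norm (w x * F k x) \<le> \<bar>w x\<bar>" for k
        by (auto simp: abs_mult F_def intro!: mult_left_le)
    qed (use w in auto)
    then have "(\<integral>x. w x * indicator {..a} x \<partial>N) = 0"
      by (simp add: test[OF cF] LIMSEQ_const_iff)
    then show ?thesis
      by (simp add: set_lebesgue_integral_def mult.commute)
  qed
  have wset: "set_integrable N A w" if "A \<in> sets N" for A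
    unfolding set_integrable_def using w that by (auto intro!: integrable_mult_indicator simp del: real_scaleR_def)
  have "(LINT x:A|N. w x) = 0" if "A \<in> sets N" for A
  proof -
    have borel: "sets N = sigma_sets UNIV (range (\<lambda>a::real. {..a}))"
      unfolding N by (simp add: borel_eq_atMost)
    have "Int_stable (range (\<lambda>a::real. {..a}))"
      by (auto simp: Int_stable_def)
    moreover have "range (\<lambda>a::real. {..a}) \<subseteq> Pow UNIV"
      by simp
    moreover have "A \<in> sigma_sets UNIV (range (\<lambda>a::real. {..a}))"
      using that by (simp only: borel)
    ultimately show ?thesis
    proof (induction A rule: sigma_sets_induct_disjoint)
      case (compl A)
      then have A: "A \<in> sets N" by (simp only: borel)
      have "(\<integral>x. w x \<partial>N) = 0" using moments[of 0] by simp
      moreover have "(LINT x:UNIV|N. w x) = (LINT x:A|N. w x) + (LINT x:UNIV - A|N. w x)"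
        using set_integral_Un[of A "UNIV - A" N w] wset A sets.compl_sets[OF A] sets_eq_imp_space_eq[OF N] by auto
      ultimately show ?case
        using compl by (simp add: set_lebesgue_integral_def)
    next
      case (union A)
      then have "A i \<in> sets N" for i by (auto simp only: borel)
      then show ?case
        using union by (subst lebesgue_integral_countable_add) (auto simp: disjoint_family_on_def intro!: wset)
    qed (use ray in \<open>auto simp: set_lebesgue_integral_def\<close>)
  qed
  then show ?thesis
    using w by (intro density_unique_real[of N w "\<lambda>_. 0"]) auto
qed

section \<open>The reciprocal of the inner product\<close>

lemma reciprocal_not_integrable:
  fixes a b :: real
  assumes "a < b"
  shows "\<not> set_integrable lborel {a<..b} (\<lambda>t. 1 / (t - a))"
proof
  assume "set_integrable lborel {a<..b} (\<lambda>t. 1 / (t - a))"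
  then have int: "(\<lambda>t. 1 / (t - a)) integrable_on {a<..b}"
    by (rule set_borel_integral_eq_integral)
  define I where "I = integral {a<..b} (\<lambda>t. 1 / (t - a))"
  have "0 \<le> I"
    unfolding I_def by (rule Henstock_Kurzweil_Integration.integral_nonneg[OF int]) auto
  \<comment> \<open>chosen so that the integral over \<open>[a + d, b]\<close> is \<open>I + 1\<close>, exceeding the integral over \<open>(a, b]\<close>\<close>
  define d where "d = (b - a) * exp (- I - 1)"
  have d: "0 < d" "d \<le> b - a"
    using assms \<open>0 \<le> I\<close> by (auto simp: d_def mult_le_cancel_left1)
  have FTC: "((\<lambda>t. 1 / (t - a)) has_integral (ln (b - a) - ln (a + d - a))) {a + d..b}"
    using d by (intro fundamental_theorem_of_calculus)
      (auto intro!: derivative_eq_intros simp: has_real_derivative_iff_has_vector_derivative[symmetric] divide_inverse)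
  have "ln (b - a) - ln (a + d - a) = I + 1"
    using assms by (simp add: d_def ln_mult)
  moreover have "ln (b - a) - ln (a + d - a) \<le> I"
    unfolding integral_unique[OF FTC, symmetric] I_def
    by (rule integral_subset_le) (use d FTC int in auto)
  ultimately show False by simp
qed

text \<open>On every section the function is \<open>1 / cos (s - t)\<close>, whose singularity at a zero of the cosine is as
  bad as that of \<open>1 / (t - a)\<close>.\<close>

lemma reciprocal_inner_not_integrable: "\<not> integrable torus_measure (\<lambda>(x, y). 1 / (x \<bullet> y))"
proof
  assume int: "integrable torus_measure (\<lambda>(x, y). 1 / (x \<bullet> y))"
  from torus.AE_integrable_fst[OF int]
  obtain s where s: "0 \<le> s" "s < 2*pi" and *: "integrable sigma1 (\<lambda>y. 1 / (circ s \<bullet> y))"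
    by (rule circle_AE_E)
  have cos_int: "set_integrable lborel {0..<2*pi} (\<lambda>t. 1 / cos (s - t))"
    using * integrable_sigma1[OF borel_measurable_integrable[OF *]] by (simp add: inner_circ)
  \<comment> \<open>a zero of \<open>cos (s - t)\<close> in \<open>[0, 2*pi)\<close>, to the right or to the left of \<open>s\<close>\<close>
  define a where "a = (if s < 3*pi/2 then s + pi/2 else s - pi/2)"
  have a: "0 \<le> a" "a < 2*pi" and cos_sin: "\<bar>cos (s - t)\<bar> = \<bar>sin (t - a)\<bar>" for t
    using s by (auto simp: a_def cos_diff sin_diff sin_add cos_add algebra_simps)
  \<comment> \<open>within distance \<open>1 < pi\<close> of \<open>a\<close> the sine stays positive, so the convention \<open>1 / 0 = 0\<close> cannot interfere\<close>
  obtain b where "a < b" "b < min (2*pi) (a + 1)"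
    using dense[of a "min (2*pi) (a + 1)"] a by auto
  then have b: "a < b" "b < 2*pi" "b \<le> a + 1"
    by simp_all
  have near_zero: "set_integrable lborel {a<..b} (\<lambda>t. 1 / cos (s - t))"
    by (rule set_integrable_subset[OF cos_int]) (use a b in auto)
  have meas: "set_borel_measurable lborel {a<..b} (\<lambda>t. 1 / (t - a))"
    unfolding set_borel_measurable_def by measurable
  have le: "norm (1 / (t - a)) \<le> norm (1 / cos (s - t))" if t: "t \<in> {a<..b}" for t
  proof -
    have "0 < sin (t - a)"
      using t b pi_gt3 by (intro sin_gt_zero) auto
    moreover have "sin (t - a) \<le> t - a"
      using t by (intro sin_x_le_x) auto
    ultimately show ?thesis
      using t cos_sin[of t] by (simp add: frac_le)
  qed
  have "set_integrable lborel {a<..b} (\<lambda>t. 1 / (t - a))"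
    by (rule set_integrable_bound[OF near_zero meas]) (use le in auto)
  with reciprocal_not_integrable[OF b(1)] show False ..
qed

lemma AE_inner_nonzero: "AE z in torus_measure. (case z of (x, y) \<Rightarrow> x \<bullet> y) \<noteq> 0"
proof (rule torus.AE_pair_measure)
  show "{z \<in> space torus_measure. (case z of (x, y) \<Rightarrow> x \<bullet> y) \<noteq> 0} \<in> sets torus_measure"
    by measurable
  have slice: "AE y in sigma1. x \<bullet> y \<noteq> 0" if "x \<in> circle" for x
  proof -
    obtain s where x: "x = circ s" using \<open>x \<in> circle\<close> by (metis circle_cases)
    have [measurable]: "(\<lambda>y. x \<bullet> y) \<in> borel_measurable sigma1"
      by (intro borel_measurable_sigma1 continuous_intros)
    show ?thesis
    proof (rule AE_sigma1I)
      have "{t. cos (s - t) = 0} \<subseteq> range (\<lambda>i::int. s - i * (pi/2))"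
      proof
        fix t assume "t \<in> {t. cos (s - t) = 0}"
        then obtain i :: int where "s - t = i * (pi/2)"
          by (auto simp: cos_zero_iff_int)
        then show "t \<in> range (\<lambda>i::int. s - i * (pi/2))"
          by (intro image_eqI[of _ _ i]) auto
      qed
      then have "countable {t. cos (s - t) = 0}"
        by (rule countable_subset) simp
      from AE_not_in[OF countable_imp_null_set_lborel[OF this]]
      show "AE t in lborel. x \<bullet> circ t \<noteq> 0"
        by eventually_elim (simp add: x inner_circ)
    qed measurable
  qed
  show "AE x in sigma1. AE y in sigma1. (case (x, y) of (x, y) \<Rightarrow> x \<bullet> y) \<noteq> 0"
    unfolding prod.case by (rule AE_I2) (simp only: space_sigma1 slice)
qed

section \<open>Uniqueness\<close>

text \<open>Measurability of \<open>\<phi> (x \<bullet> y)\<close> on the torus passes to \<open>\<phi>\<close> itself along the measurable curve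
  \<open>\<alpha> \<mapsto> (circ 0, circ (arccos \<alpha>))\<close>, on which the inner product equals \<open>\<alpha>\<close>.\<close>

lemma zonal_profile_measurable:
  fixes \<phi> :: "real \<Rightarrow> real"
  assumes "(\<lambda>(x, y). \<phi> (x \<bullet> y)) \<in> borel_measurable torus_measure"
  shows "(\<lambda>\<alpha>. indicator {-1..1} \<alpha> * \<phi> \<alpha>) \<in> borel_measurable borel"
proof -
  have "continuous_on {-1..1} (\<lambda>\<alpha>. circ (arccos \<alpha>))"
    by (rule continuous_on_compose2[OF circ_continuous[of UNIV] continuous_on_arccos']) auto
  then have "(\<lambda>\<alpha>. circ (arccos \<alpha>)) \<in> restrict_space borel {-1..1} \<rightarrow>\<^sub>M restrict_space borel circle"
    by (intro measurable_restrict_space2 borel_measurable_continuous_on_restrict) auto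
  then have "(\<lambda>\<alpha>. circ (arccos \<alpha>)) \<in> restrict_space borel {-1..1} \<rightarrow>\<^sub>M sigma1"
    by (simp cong: measurable_cong_sets)
  then have "(\<lambda>\<alpha>. (circ 0, circ (arccos \<alpha>))) \<in> restrict_space borel {-1..1} \<rightarrow>\<^sub>M torus_measure"
    by (intro measurable_Pair measurable_const) auto
  from measurable_compose[OF this assms]
  have "(\<lambda>\<alpha>. \<phi> (circ 0 \<bullet> circ (arccos \<alpha>))) \<in> borel_measurable (restrict_space borel {-1..1})"
    by simp
  also have "?this \<longleftrightarrow> \<phi> \<in> borel_measurable (restrict_space borel {-1..1})"
    by (rule measurable_cong) (simp add: inner_circ space_restrict_space cos_arccos)
  finally show ?thesis
    by (simp add: borel_measurable_restrict_space_iff)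
qed

text \<open>Subtracting the mean \<open>c\<close> of \<open>\<alpha> * \<phi> \<alpha>\<close> makes it orthogonal to the constant polynomial as well, while
  the other Chebyshev polynomials have mean zero. The recursion spreads orthogonality to all
  powers, so \<open>\<alpha> * \<phi> \<alpha> = c\<close> almost everywhere, and integrability of \<open>\<phi> \<alpha> = c / \<alpha>\<close> forces
  \<open>c = 0\<close>.\<close>

lemma zonal_moments_determine:
  fixes \<phi> :: "real \<Rightarrow> real"
  defines "X \<equiv> \<lambda>(x::real^2, y). x \<bullet> y"
  assumes int: "integrable torus_measure (\<lambda>z. \<phi> (X z))"
    and orth: "\<And>n. n \<noteq> 0 \<Longrightarrow> (\<integral>z. \<phi> (X z) * (X z * chebyshev n (X z)) \<partial>torus_measure) = 0"
  shows "AE z in torus_measure. \<phi> (X z) = 0"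
proof -
  have X [measurable]: "X \<in> borel_measurable torus_measure"
    unfolding X_def by (rule inner_torus_measurable)
  have Xb: "X z \<in> {-1..1}" if "z \<in> space torus_measure" for z
    unfolding X_def by (rule inner_torus_bounds[OF that])
  have [measurable]: "(\<lambda>\<alpha>. indicator {-1..1} \<alpha> * \<phi> \<alpha>) \<in> borel_measurable borel"
    using borel_measurable_integrable[OF int] unfolding X_def
    by (intro zonal_profile_measurable) (simp add: case_prod_unfold)
  have [measurable]: "chebyshev n \<in> borel_measurable borel" for n
    by (rule borel_measurable_continuous_onI[OF chebyshev_continuous])
  have bint: "integrable torus_measure (\<lambda>z. p z * F (X z))"
    if p: "integrable torus_measure p" and F: "continuous_on UNIV F" for p :: "_ \<Rightarrow> real" and F :: "real \<Rightarrow> real"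
    by (rule integrable_mult_continuous[OF p X compact_Icc AE_I2[OF Xb] F])
  have cint: "integrable torus_measure (\<lambda>z. c)" for c :: real
    by simp
  have total: "measure torus_measure (space torus_measure) = 1"
    by (simp add: measure_def emeasure_torus)
  define c where "c = (\<integral>z. \<phi> (X z) * X z \<partial>torus_measure)"
  \<comment> \<open>the indicator turns the profile, which is measurable on \<open>[-1, 1]\<close>, into a Borel function on the line\<close>
  define w where "w \<alpha> = \<alpha> * (indicator {-1..1} \<alpha> * \<phi> \<alpha>) - c" for \<alpha>
  have wm [measurable]: "w \<in> borel_measurable borel"
    unfolding w_def by measurable
  have wX: "w (X z) = \<phi> (X z) * X z - c" if "z \<in> space torus_measure" for z
    using Xb[OF that] by (simp add: w_def)
  have phiX: "integrable torus_measure (\<lambda>z. \<phi> (X z) * X z)"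
    by (rule bint[OF int continuous_on_id])
  have wint: "integrable torus_measure (\<lambda>z. w (X z))"
    using Bochner_Integration.integrable_diff[OF phiX cint[of c]]
    by (rule Bochner_Integration.integrable_cong[THEN iffD1, rotated 2]) (auto simp: wX)
  have chebyshev0: "(\<integral>z. w (X z) * chebyshev n (X z) \<partial>torus_measure) = 0" for n
  proof -
    have "(\<integral>z. w (X z) * chebyshev n (X z) \<partial>torus_measure)
        = (\<integral>z. \<phi> (X z) * (X z * chebyshev n (X z)) - c * chebyshev n (X z) \<partial>torus_measure)"
      by (intro Bochner_Integration.integral_cong) (auto simp: wX algebra_simps)
    also have "\<dots> = (\<integral>z. \<phi> (X z) * (X z * chebyshev n (X z)) \<partial>torus_measure) - c * (\<integral>z. chebyshev n (X z) \<partial>torus_measure)"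
    proof -
      have "continuous_on UNIV (\<lambda>\<alpha>. \<alpha> * chebyshev n \<alpha>)"
        by (intro continuous_intros chebyshev_continuous)
      from bint[OF int this] bint[OF cint chebyshev_continuous, of c n] show ?thesis
        by (subst Bochner_Integration.integral_diff) auto
    qed
    also have "\<dots> = 0"
    proof (cases "n = 0")
      case True
      then show ?thesis by (simp add: c_def[symmetric] total)
    next
      case False
      then show ?thesis
        using chebyshev_mean_zero[OF False] orth[OF False] by (simp add: X_def case_prod_unfold)
    qed
    finally show ?thesis .
  qed
  have power0: "(\<integral>z. w (X z) * (X z ^ j * chebyshev n (X z)) \<partial>torus_measure) = 0" for j n
  proof (induction j arbitrary: n)
    case 0
    then show ?case by (simp add: chebyshev0)
  next
    case (Suc j)
    have ints: "integrable torus_measure (\<lambda>z. w (X z) * (X z ^ j * chebyshev m (X z)))" for m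
      by (rule bint[OF wint]) (intro continuous_intros chebyshev_continuous)
    show ?case
    proof (cases n)
      case 0
      then show ?thesis using Suc.IH[of 1] by (simp add: ac_simps)
    next
      case (Suc m)
      \<comment> \<open>the three-term recursion, solved for \<open>\<alpha> * chebyshev (Suc m) \<alpha>\<close>\<close>
      have "(\<integral>z. w (X z) * (X z ^ Suc j * chebyshev n (X z)) \<partial>torus_measure)
        = (\<integral>z. (w (X z) * (X z ^ j * chebyshev (Suc (Suc m)) (X z)) + w (X z) * (X z ^ j * chebyshev m (X z))) / 2 \<partial>torus_measure)"
        by (rule arg_cong[where f="integral\<^sup>L torus_measure"]) (simp add: fun_eq_iff Suc algebra_simps)
      also have "\<dots> = 0"
        using Suc.IH[of "Suc (Suc m)"] Suc.IH[of m] ints[of "Suc (Suc m)"] ints[of m] by (simp del: chebyshev.simps)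
      finally show ?thesis .
    qed
  qed
  have "AE \<alpha> in distr torus_measure borel X. w \<alpha> = 0"
  proof (rule AE_zero_if_moments_zero)
    show "AE \<alpha> in distr torus_measure borel X. \<alpha> \<in> {-1..1}"
      using Xb by (subst AE_distr_iff) (auto intro!: AE_I2 simp del: atLeastAtMost_iff)
    show "integrable (distr torus_measure borel X) w"
      using wint by (simp add: integrable_distr_eq)
    show "(\<integral>\<alpha>. w \<alpha> * \<alpha> ^ j \<partial>distr torus_measure borel X) = 0" for j
      using power0[of j 0] by (subst integral_distr) auto
  qed simp
  then have "AE z in torus_measure. w (X z) = 0"
    by (subst (asm) AE_distr_iff) auto
  then have eq: "AE z in torus_measure. \<phi> (X z) * X z = c"
    using AE_space by eventually_elim (simp add: wX)
  have "c = 0"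
  proof (rule ccontr)
    assume "c \<noteq> 0"
    have "integrable torus_measure (\<lambda>z. \<phi> (X z) / c)"
      using int by simp
    also have "?this \<longleftrightarrow> integrable torus_measure (\<lambda>z. 1 / X z)"
    proof (rule integrable_cong_AE)
      show "(\<lambda>z. \<phi> (X z) / c) \<in> borel_measurable torus_measure"
        using int by auto
      show "AE z in torus_measure. \<phi> (X z) / c = 1 / X z"
        using eq by eventually_elim (use \<open>c \<noteq> 0\<close> in \<open>auto simp: field_simps\<close>)
    qed measurable
    finally show False
      using reciprocal_inner_not_integrable by (simp add: X_def case_prod_unfold)
  qed
  show ?thesis
    using eq AE_inner_nonzero by eventually_elim (use \<open>c = 0\<close> in \<open>auto simp: X_def\<close>)
qed

text \<open>The covariance of each harmonic with itself is the same for both measures; these tests alone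
  determine the density almost everywhere.\<close>

lemma represents_covariance_unique:
  assumes "represents_covariance \<nu>" "represents_covariance \<nu>'"
  shows "\<nu> = \<nu>'"
proof -
  let ?G = "\<lambda>f g (x, y). spherical_gradient f x \<bullet> spherical_gradient g y"
  define X where "X = (\<lambda>(x::real^2, y). x \<bullet> y)"
  obtain \<psi> where \<psi>: "has_signed_density torus_measure \<nu> (\<lambda>z. \<psi> (X z))"
    using assms(1) unfolding represents_covariance_def X_def case_prod_unfold by auto
  obtain \<psi>' where \<psi>': "has_signed_density torus_measure \<nu>' (\<lambda>z. \<psi>' (X z))"
    using assms(2) unfolding represents_covariance_def X_def case_prod_unfold by auto
  have int: "integrable torus_measure (\<lambda>z. \<psi> (X z))" "integrable torus_measure (\<lambda>z. \<psi>' (X z))"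
    using \<psi> \<psi>' by (auto simp: has_signed_density_def)
  define \<phi> where "\<phi> \<alpha> = \<psi> \<alpha> - \<psi>' \<alpha>" for \<alpha>
  have intd: "integrable torus_measure (\<lambda>z. \<phi> (X z))"
    unfolding \<phi>_def using int by simp
  have orth: "(\<integral>z. \<phi> (X z) * ?G f f z \<partial>torus_measure) = 0" if f: "C1_on_circle f" for f
  proof -
    note G = gradient_product_integrable(1)[OF int(1) f f]
      gradient_product_integrable(2)[OF int(1) f f] gradient_product_integrable(2)[OF int(2) f f]
    have "(\<integral>z. \<psi> (X z) * ?G f f z \<partial>torus_measure) = covariance sigma1 f f"
      using signed_integral_density[OF \<psi> G(1,2)] assms(1) f by (simp add: represents_covariance_def)
    moreover have "(\<integral>z. \<psi>' (X z) * ?G f f z \<partial>torus_measure) = covariance sigma1 f f"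
      using signed_integral_density[OF \<psi>' G(1,3)] assms(2) f by (simp add: represents_covariance_def)
    ultimately show ?thesis
      unfolding \<phi>_def left_diff_distrib by (subst Bochner_Integration.integral_diff) (use G in auto)
  qed
  have "(\<integral>z. \<phi> (X z) * (X z * chebyshev n (X z)) \<partial>torus_measure) = 0" if "n \<noteq> 0" for n
  proof -
    let ?H = "\<lambda>a. ?G (harmonic a n) (harmonic a n)"
    have "(real n)\<^sup>2 * (\<integral>z. \<phi> (X z) * (X z * chebyshev n (X z)) \<partial>torus_measure)
        = (\<integral>z. (real n)\<^sup>2 * (\<phi> (X z) * (X z * chebyshev n (X z))) \<partial>torus_measure)"
      by simp
    also have "\<dots> = (\<integral>z. \<phi> (X z) * ?H 1 z + \<phi> (X z) * ?H (- \<i>) z \<partial>torus_measure)"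
    proof (rule Bochner_Integration.integral_cong[OF refl])
      fix z assume "z \<in> space torus_measure"
      then obtain x y where z: "z = (x, y)" and xy: "x \<in> circle" "y \<in> circle"
        by (cases z) (simp add: space_pair_measure)
      have "\<phi> (X z) * (?H 1 z + ?H (- \<i>) z) = \<phi> (X z) * ((real n)\<^sup>2 * (X z * chebyshev n (X z)))"
        using harmonic_gradients_chebyshev[OF xy] by (simp add: z X_def)
      then show "(real n)\<^sup>2 * (\<phi> (X z) * (X z * chebyshev n (X z))) = \<phi> (X z) * ?H 1 z + \<phi> (X z) * ?H (- \<i>) z"
        by (simp only: distrib_left mult.left_commute)
    qed
    also have "\<dots> = 0"
      using orth[OF harmonic_C1] gradient_product_integrable(2)[OF intd harmonic_C1 harmonic_C1]
      by (subst Bochner_Integration.integral_add) auto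
    finally show ?thesis
      using that by simp
  qed
  from zonal_moments_determine[OF intd[unfolded X_def] this[unfolded X_def]]
  have zero: "AE z in torus_measure. \<phi> (X z) = 0"
    by (simp add: X_def)
  show ?thesis
  proof
    fix A
    show "\<nu> A = \<nu>' A"
    proof (cases "A \<in> sets torus_measure")
      case True
      have "(LINT z:A|torus_measure. \<psi> (X z)) = (LINT z:A|torus_measure. \<psi>' (X z))"
        unfolding set_lebesgue_integral_def
      proof (rule integral_cong_AE)
        show "AE z in torus_measure. indicator A z *\<^sub>R \<psi> (X z) = indicator A z *\<^sub>R \<psi>' (X z)"
          using zero by eventually_elim (simp add: \<phi>_def)
      qed (use int True in measurable)
      then show ?thesis
        using True \<psi> \<psi>' by (simp add: has_signed_density_def)
    next
      case False
      then show ?thesis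
        using assms unfolding represents_covariance_def signed_measure_def by metis
    qed
  qed
qed

section \<open>The representation theorem\<close>

theorem proposition19p1:
  shows "(\<exists>!\<nu>. represents_covariance \<nu>) \<and>
    (\<forall>\<nu>. represents_covariance \<nu> \<longrightarrow>
      (\<exists>\<psi>::real \<Rightarrow> real.
        has_signed_density torus_measure \<nu> (\<lambda>(x, y). \<psi> (x \<bullet> y)) \<and>
        continuous_on {-1..1} \<psi> \<and>
        (\<forall>\<alpha>\<in>{-1..1}. \<psi> \<alpha> > 0) \<and>
        strict_mono_on {-1..1} \<psi> \<and>
        (\<forall>h\<in>{0..2*pi}. cos h \<noteq> 0 \<longrightarrow> \<psi> (cos h) = (2*pi)^2 * (K (h / (2*pi)) / cos h)) \<and>
        (\<forall>h\<in>{0..2*pi}. cos h = 0 \<longrightarrow>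
           ((\<lambda>s. (2*pi)^2 * (K (s / (2*pi)) / cos s)) \<longlongrightarrow> \<psi> (cos h)) (at h)) \<and>
        (\<forall>\<alpha>\<in>{-1..1}. pi^2 / 8 \<le> \<psi> \<alpha> \<and> \<psi> \<alpha> \<le> 3 * pi^2 / 8) \<and>
        \<psi> (-1) = pi^2 / 8 \<and> \<psi> 1 = 3 * pi^2 / 8))"
proof (intro conjI allI impI)
  show "\<exists>!\<nu>. represents_covariance \<nu>"
    using nu_represents represents_covariance_unique by blast
next
  fix \<nu> assume "represents_covariance \<nu>"
  then have "\<nu> = nu"
    using nu_represents by (rule represents_covariance_unique)
  moreover have "psi \<alpha> > 0" if "\<alpha> \<in> {-1..1}" for \<alpha>
    using psi_bounds(1)[OF that] by (rule less_le_trans[rotated]) simp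
  moreover have "psi (cos h) = (2*pi)^2 * (K (h / (2*pi)) / cos h)" if "h \<in> {0..2*pi}" "cos h \<noteq> 0" for h
    using psi_cos[of h] that unfolding times_divide_eq_right kappa_K by (simp add: eq_divide_eq)
  ultimately show "\<exists>\<psi>::real \<Rightarrow> real.
        has_signed_density torus_measure \<nu> (\<lambda>(x, y). \<psi> (x \<bullet> y)) \<and>
        continuous_on {-1..1} \<psi> \<and>
        (\<forall>\<alpha>\<in>{-1..1}. \<psi> \<alpha> > 0) \<and>
        strict_mono_on {-1..1} \<psi> \<and>
        (\<forall>h\<in>{0..2*pi}. cos h \<noteq> 0 \<longrightarrow> \<psi> (cos h) = (2*pi)^2 * (K (h / (2*pi)) / cos h)) \<and>
        (\<forall>h\<in>{0..2*pi}. cos h = 0 \<longrightarrow>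
           ((\<lambda>s. (2*pi)^2 * (K (s / (2*pi)) / cos s)) \<longlongrightarrow> \<psi> (cos h)) (at h)) \<and>
        (\<forall>\<alpha>\<in>{-1..1}. pi^2 / 8 \<le> \<psi> \<alpha> \<and> \<psi> \<alpha> \<le> 3 * pi^2 / 8) \<and>
        \<psi> (-1) = pi^2 / 8 \<and> \<psi> 1 = 3 * pi^2 / 8"
    using nu_density psi_continuous psi_strict_mono psi_limit psi_bounds psi_values
    by (intro exI[of _ psi]) blast
qed

end
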